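(* Let $n>3$ be odd and let $s=(1,n)(2,n-1)\cdots(\frac{n-1}2,\frac{n+3}2)(\frac{n+1}2)\in D_n\subset S_n$. Let $\chi(s)$ be the trace of the representation of $s$ on $\overline{FK}_{C_n}(n)$. Then $$[\chi(s)](q)=\sum_{k=0}^{\lfloor\frac{n-1}{4}\rfloor}\binom{\frac{n-1}{2}-k}{k}q^{2k}-\sum_{k=0}^{\lfloor\frac{n-3}{4}\rfloor}\binom{\frac{n-3}{2}-k}{k}q^{2k+1},$$ with $q$-Fibonacci version $$[\chi(s)](q)=F_{\frac{n-1}{2}}(q^2)-qF_{\frac{n-3}{2}}(q^2).$$
   Context: Let $F$ be a field and $n>3$. $\overline{FK}_{C_n}(n)$ is the quotient of the Fomin-Kirillov algebra $FK(n)$ by the ideal generated by the $x_{ij}$ for which $\{i,j\}$ is not an edge of the $n$-cycle $C_n$ (vertices $1,\dots,n$, edges $\overline{12},\overline{23},\dots,\overline{n-1,n},\overline{1n}$). Explicitly, it is the associative unital $F$-algebra on generators $x_{1n}=-x_{n1}$ and $x_{m,m+1}=-x_{m+1,m}$ ($1\le m\le n-1$), that is, the free associative algebra on the $n$ letters $x_{12},x_{23},\dots,x_{n-1,n},x_{1n}$ modulo the two-sided ideal generated by the relations - $x_{m,m+1}^2=0$ for $1\le m\le n-1$, and $x_{1n}^2=0$; - $x_{m,m+1}x_{m+1,m+2}=0$ and $x_{m+1,m+2}x_{m,m+1}=0$ for $1\le m\le n-2$; - $x_{n-1,n}x_{1n}=0$, $x_{1n}x_{n-1,n}=0$, $x_{12}x_{1n}=0$,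 $x_{1n}x_{12}=0$; - $x_{m,m+1}x_{l,l+1}-x_{l,l+1}x_{m,m+1}=0$ for $1\le m\le l-2$, $3\le l\le n-1$; - $x_{m,m+1}x_{1n}-x_{1n}x_{m,m+1}=0$ for $2\le m\le n-2$. The algebra is graded by usual (total) degree, each generator having degree 1. The dihedral group $D_n=\langle r,s\mid s^2=r^n=(rs)^2=1\rangle$ is realized in $S_n$ as the symmetry group of the $n$-cycle, with $r=(1\,2\,\cdots\,n)$ and $s$ the permutation $i\mapsto n+1-i$. It acts on $\overline{FK}_{C_n}(n)$ by degree-preserving algebra automorphisms determined by $\sigma x_{ij}=x_{\sigma(i)\sigma(j)}$ if $\sigma(i)<\sigma(j)$ and $\sigma x_{ij}=-x_{\sigma(j)\sigma(i)}$ otherwise (extended multiplicatively to monomials and linearly). $[\chi(\sigma)](q)=\sum_{d\ge0}\operatorname{tr}\big(\sigma\,|\,\overline{FK}^{(d)}_{C_n}(n)\big)q^d$ is the graded trace (total degree decomposition), where $\overline{FK}^{(d)}_{C_n}(n)$ is the degree $d$ component. The $q$-Fibonacci polynomials are $F_m(q)=\sum_{k=0}^{\lfloor m/2\rfloor}\binom{m-k}{k}q^k$ for $m\ge0$. *)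

theory Defs
  imports
    "HOL-Library.Poly_Mapping"
    "HOL-Computational_Algebra.Formal_Power_Series"
    "HOL-Combinatorics.Permutations"
    "HOL-Algebra.QuotRing"
    "HOL-Algebra.Sym_Groups"
    "Jordan_Normal_Form.VS_Connect"
begin

hide_const (open) Polynomial.smult

section \<open>Free associative algebras\<close>

text \<open>
  Lists under concatenation form the free monoid. With this instance the library's convolution
  product on finitely supported functions makes \<open>'x list \<Rightarrow>\<^sub>0 'a\<close> the free associative
  unital \<open>'a\<close>-algebra on the letters of type \<open>'x\<close>; \<open>single w c\<close> is the monomial \<open>c w\<close>.
\<close>

instantiation list :: (type) monoid_add
begin

definition zero_list :: "'a list" where "zero_list = []"

definition plus_list :: "'a list \<Rightarrow> 'a list \<Rightarrow> 'a list" where "plus_list u v = u @ v"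

instance by standard (simp_all add: zero_list_def plus_list_def)

end

definition free_algebra :: "'x set \<Rightarrow> ('a::field, 'x list \<Rightarrow>\<^sub>0 'a) module" where
  "free_algebra X =
    \<lparr>carrier = {p. \<forall>w \<in> Poly_Mapping.keys p. set w \<subseteq> X}, mult = (*), one = 1, zero = 0, add = (+),
     smult = (\<lambda>c p. Poly_Mapping.single [] c * p)\<rparr>"


section \<open>The algebra of the n-cycle\<close>

text \<open>The letter \<open>(i, j)\<close> with \<open>i < j\<close> stands for the generator \<open>x\<^sub>i\<^sub>j\<close>.\<close>

definition cycle_letters :: "nat \<Rightarrow> (nat \<times> nat) set" where
  "cycle_letters n = insert (1, n) {(m, m + 1) |m. 1 \<le> m \<and> m \<le> n - 1}"

text \<open>\<open>gen i j\<close> is \<open>x\<^sub>i\<^sub>j\<close> for arbitrary distinct indices, with the convention \<open>x\<^sub>j\<^sub>i = - x\<^sub>i\<^sub>j\<close>.\<close>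

definition gen :: "nat \<Rightarrow> nat \<Rightarrow> (nat \<times> nat) list \<Rightarrow>\<^sub>0 'a::field" where
  "gen i j = (if i < j then Poly_Mapping.single [(i, j)] 1 else - Poly_Mapping.single [(j, i)] 1)"

definition FK_relations :: "nat \<Rightarrow> ((nat \<times> nat) list \<Rightarrow>\<^sub>0 'a::field) set" where
  "FK_relations n =
     {gen m (m+1) * gen m (m+1) |m. 1 \<le> m \<and> m \<le> n - 1}
   \<union> {gen 1 n * gen 1 n}
   \<union> {gen m (m+1) * gen (m+1) (m+2) |m. 1 \<le> m \<and> m \<le> n - 2}
   \<union> {gen (m+1) (m+2) * gen m (m+1) |m. 1 \<le> m \<and> m \<le> n - 2}
   \<union> {gen (n-1) n * gen 1 n, gen 1 n * gen (n-1) n, gen 1 2 * gen 1 n, gen 1 n * gen 1 2}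
   \<union> {gen m (m+1) * gen l (l+1) - gen l (l+1) * gen m (m+1) |m l.
        1 \<le> m \<and> m \<le> l - 2 \<and> 3 \<le> l \<and> l \<le> n - 1}
   \<union> {gen m (m+1) * gen 1 n - gen 1 n * gen m (m+1) |m. 2 \<le> m \<and> m \<le> n - 2}"

definition FK_free :: "nat \<Rightarrow> ('a::field, (nat \<times> nat) list \<Rightarrow>\<^sub>0 'a) module" where
  "FK_free n = free_algebra (cycle_letters n)"

definition FK_ideal :: "nat \<Rightarrow> ((nat \<times> nat) list \<Rightarrow>\<^sub>0 'a::field) set" where
  "FK_ideal n = genideal (FK_free n) (FK_relations n)"

text \<open>
  The quotient algebra: the ring structure is the library's factor ring; scalar multiplication is
  induced from representatives, in the same style as \<^const>\<open>rcoset_mult\<close>.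
\<close>

definition FK_cycle :: "nat \<Rightarrow> ('a::field, ((nat \<times> nat) list \<Rightarrow>\<^sub>0 'a) set) module" where
  "FK_cycle n =
     ring.extend (FK_free n Quot FK_ideal n)
       (module.fields (\<lambda>c A. \<Union>p\<in>A. FK_ideal n +>\<^bsub>FK_free n\<^esub> (c \<odot>\<^bsub>FK_free n\<^esub> p)))"

definition FK_degree :: "nat \<Rightarrow> nat \<Rightarrow> ((nat \<times> nat) list \<Rightarrow>\<^sub>0 'a::field) set set" where
  "FK_degree n d = (\<lambda>p. FK_ideal n +>\<^bsub>FK_free n\<^esub> p) `
     {p \<in> carrier (FK_free n). \<forall>w \<in> Poly_Mapping.keys p. length w = d}"


section \<open>The dihedral action\<close>

definition rotation :: "nat \<Rightarrow> nat \<Rightarrow> nat" where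
  "rotation n i = (if i \<in> {1..n} then (if i = n then 1 else i + 1) else i)"

definition reflection :: "nat \<Rightarrow> nat \<Rightarrow> nat" where
  "reflection n i = (if i \<in> {1..n} then n + 1 - i else i)"

definition dihedral :: "nat \<Rightarrow> (nat \<Rightarrow> nat) set" where
  "dihedral n = generate (sym_group n) {rotation n, reflection n}"

lemma reflection_in_dihedral: "reflection n \<in> dihedral n"
  by (simp add: dihedral_def generate.incl)

text \<open>The cycle notation \<open>(1,n)(2,n-1)\<cdots>\<close> of the reflection.\<close>

lemma reflection_eq_transpositions:
  "reflection n = foldr (\<lambda>i f. transpose i (n + 1 - i) \<circ> f) [1..<n div 2 + 1] id"
proof -
  have *: "foldr (\<lambda>i f. transpose i (n + 1 - i) \<circ> f) [1..<k + 1] g x =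
      (let y = g x in if (1 \<le> y \<and> y \<le> k) \<or> (n + 1 - k \<le> y \<and> y \<le> n) then n + 1 - y else y)"
    if "2 * k \<le> n" for k g x
    using that
  proof (induction k arbitrary: g)
    case 0
    then show ?case by (auto simp: Let_def)
  next
    case (Suc k)
    have upt: "[1..<Suc k + 1] = [1..<k + 1] @ [Suc k]" by simp
    have IH: "foldr (\<lambda>i f. transpose i (n + 1 - i) \<circ> f) [1..<k + 1] h x =
      (let y = h x in if (1 \<le> y \<and> y \<le> k) \<or> (n + 1 - k \<le> y \<and> y \<le> n) then n + 1 - y else y)" for h
      by (rule Suc.IH) (use Suc.prems in simp)
    have "foldr (\<lambda>i f. transpose i (n + 1 - i) \<circ> f) [1..<Suc k + 1] g x =
      foldr (\<lambda>i f. transpose i (n + 1 - i) \<circ> f) [1..<k + 1] (transpose (Suc k) (n - k) \<circ> g) x"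
      unfolding upt foldr_append by simp
    also have "\<dots> = (let y = transpose (Suc k) (n - k) (g x)
      in if (1 \<le> y \<and> y \<le> k) \<or> (n + 1 - k \<le> y \<and> y \<le> n) then n + 1 - y else y)"
      by (subst IH) simp
    finally show ?case
      by (rule trans) (use Suc.prems in \<open>auto simp: Let_def transpose_def\<close>)
  qed
  show ?thesis
    by (rule ext, subst *) (auto simp: reflection_def Let_def)
qed

definition free_act :: "(nat \<Rightarrow> nat) \<Rightarrow> ((nat \<times> nat) list \<Rightarrow>\<^sub>0 'a::field) \<Rightarrow> (nat \<times> nat) list \<Rightarrow>\<^sub>0 'a" where
  "free_act \<sigma> p = (\<Sum>w \<in> Poly_Mapping.keys p.
     Poly_Mapping.single [] (Poly_Mapping.lookup p w) * prod_list (map (\<lambda>(i, j). gen (\<sigma> i) (\<sigma> j)) w))"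

text \<open>The induced map on cosets; it is the intended automorphism for \<open>\<sigma> \<in> dihedral n\<close>.\<close>

definition FK_act ::
  "nat \<Rightarrow> (nat \<Rightarrow> nat) \<Rightarrow> ((nat \<times> nat) list \<Rightarrow>\<^sub>0 'a::field) set \<Rightarrow> ((nat \<times> nat) list \<Rightarrow>\<^sub>0 'a) set" where
  "FK_act n \<sigma> A = (\<Union>p\<in>A. FK_ideal n +>\<^bsub>FK_free n\<^esub> free_act \<sigma> p)"


section \<open>Traces\<close>

definition coordinates ::
  "('k, 'm) ring_scheme \<Rightarrow> ('k, 'v, 'n) module_scheme \<Rightarrow> 'v set \<Rightarrow> 'v \<Rightarrow> 'v \<Rightarrow> 'k" where
  "coordinates K V B v = (THE a. a \<in> B \<rightarrow>\<^sub>E carrier K \<and> module.lincomb V a B = v)"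

text \<open>
  The trace of an endomorphism of a finite-dimensional space: the sum of the diagonal coefficients
  with respect to some basis (the value does not depend on the choice). Unspecified in infinite
  dimension.
\<close>

definition trace_on :: "('k, 'm) ring_scheme \<Rightarrow> ('k, 'v, 'n) module_scheme \<Rightarrow> ('v \<Rightarrow> 'v) \<Rightarrow> 'k" where
  "trace_on K V T =
     (let B = (SOME B. finite B \<and> vectorspace.basis K V B)
      in \<Oplus>\<^bsub>K\<^esub>b\<in>B. coordinates K V B (T b) b)"

definition graded_trace :: "nat \<Rightarrow> (nat \<Rightarrow> nat) \<Rightarrow> 'a::field fps" where
  "graded_trace n \<sigma> =
     Abs_fps (\<lambda>d. trace_on class_ring (FK_cycle n\<lparr>carrier := FK_degree n d\<rparr>) (FK_act n \<sigma>))"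


section \<open>q-Fibonacci polynomials\<close>

definition q_fibonacci :: "nat \<Rightarrow> 'a::comm_semiring_1 poly" where
  "q_fibonacci m = (\<Sum>k = 0..m div 2. monom (of_nat ((m - k) choose k)) k)"

end

theory Submission
  imports Defs "HOL-Combinatorics.Multiset_Permutations"
begin

text \<open>
  Two edges of the cycle that share a vertex (an edge shares both vertices with itself) multiply
  to zero in the algebra, and two disjoint edges commute. So a word vanishes unless its letters are
  pairwise disjoint, and then only its set of letters matters: the algebra is spanned by one
  monomial \<open>x\<^sub>M\<close> for every matching \<open>M\<close>. These monomials are independent because the functional
  \<open>set_coeff M\<close>, which adds up the coefficients of all listings of \<open>M\<close> (the
  words in which every element of \<open>M\<close> occurs exactly once and no other letter occurs), kills the ideal for every
  matching \<open>M\<close> and takes the value 1 on \<open>x\<^sub>M\<close> and 0 on the other monomials. Hence the ideal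
  is exactly the common kernel of these functionals (lemma \<open>I_iff\<close>), and they can be used as
  coordinates on the graded pieces of the quotient.

  A trace can be computed from any finite family of vectors \<open>e\<^sub>i\<close> with linear functionals
  \<open>\<psi>\<^sub>i\<close> such that \<open>v = \<Sum> \<psi>\<^sub>i(v) e\<^sub>i\<close> for all \<open>v\<close>: it is \<open>\<Sum> \<psi>\<^sub>i(T e\<^sub>i)\<close>
  (lemma \<open>trace_on_frame\<close>). The reflection reverses the orientation of every edge, so it maps
  \<open>x\<^sub>M\<close> to \<open>(-1)^d\<close> times the monomial of the reflected matching, where \<open>d\<close> is the size of \<open>M\<close>.
  The trace in degree \<open>d\<close> is therefore \<open>(-1)^d\<close> times the number of reflection-invariant matchings
  with \<open>d\<close> edges (lemma \<open>graded_trace_reflection_nth\<close>).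

  For \<open>n = 2 h + 3\<close> the reflection fixes the edge \<open>{1, n}\<close> and the vertex \<open>h + 2\<close>. The two edges at
  that vertex are swapped and meet, so an invariant matching avoids both. It consists of a set of
  pairwise disjoint edges of the path on \<open>1, \<dots>, h + 1\<close>, of the mirror images of these edges, and
  possibly of the edge \<open>{1, n}\<close>, which excludes the first edge of the path. An even number \<open>2 k\<close> of
  edges thus means a choice of \<open>k\<close> among \<open>h\<close> consecutive edges without two neighbours, and an odd
  number \<open>2 k + 1\<close> means the same with \<open>h - 1\<close> edges; such choices are counted by the binomial
  coefficients of the \<open>q\<close>-Fibonacci polynomials.
\<close>

section \<open>Traces from frames\<close>

context
  fixes V :: "('a::field, 'v, 'm) module_scheme"
  assumes V: "vectorspace class_ring V"
begin

interpretation V: vectorspace class_ring V by (rule V)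

lemma linear_finsum:
  assumes lin: "\<And>v w. v \<in> carrier V \<Longrightarrow> w \<in> carrier V \<Longrightarrow> \<phi> (v \<oplus>\<^bsub>V\<^esub> w) = \<phi> v + (\<phi> w :: 'a)"
    and scale: "\<And>c v. v \<in> carrier V \<Longrightarrow> \<phi> (c \<odot>\<^bsub>V\<^esub> v) = c * \<phi> v"
    and e: "\<And>i. i \<in> S \<Longrightarrow> e i \<in> carrier V"
  shows "\<phi> (\<Oplus>\<^bsub>V\<^esub>i\<in>S. c i \<odot>\<^bsub>V\<^esub> e i) = (\<Sum>i\<in>S. c i * \<phi> (e i))"
proof -
  have zero: "\<phi> \<zero>\<^bsub>V\<^esub> = 0"
    using scale[of "\<zero>\<^bsub>V\<^esub>" 0] by (simp add: V.smult_r_null)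
  show ?thesis
    using e
  proof (induction S rule: infinite_finite_induct)
    case (insert i S)
    have "(\<Oplus>\<^bsub>V\<^esub>j\<in>insert i S. c j \<odot>\<^bsub>V\<^esub> e j) = c i \<odot>\<^bsub>V\<^esub> e i \<oplus>\<^bsub>V\<^esub> (\<Oplus>\<^bsub>V\<^esub>j\<in>S. c j \<odot>\<^bsub>V\<^esub> e j)"
      using insert by (subst V.finsum_insert) (auto intro!: V.smult_closed)
    moreover have "c i \<odot>\<^bsub>V\<^esub> e i \<in> carrier V" "(\<Oplus>\<^bsub>V\<^esub>j\<in>S. c j \<odot>\<^bsub>V\<^esub> e j) \<in> carrier V"
      using insert by (auto intro!: V.smult_closed V.finsum_closed)
    ultimately show ?case using insert by (simp add: lin scale)
  qed (use zero in auto)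
qed

lemma coordinates_basis:
  assumes B: "finite B" "V.basis B" and v: "v \<in> carrier V"
  shows "coordinates class_ring V B v \<in> B \<rightarrow>\<^sub>E UNIV"
    and "(\<Oplus>\<^bsub>V\<^esub>b\<in>B. coordinates class_ring V B v b \<odot>\<^bsub>V\<^esub> b) = v"
    and "a \<in> B \<rightarrow>\<^sub>E UNIV \<Longrightarrow> (\<Oplus>\<^bsub>V\<^esub>b\<in>B. a b \<odot>\<^bsub>V\<^esub> b) = v \<Longrightarrow> a = coordinates class_ring V B v"
proof -
  have "B \<subseteq> carrier V" using B V.basis_def by auto
  then have ex: "\<exists>!a. a \<in> B \<rightarrow>\<^sub>E carrier class_ring \<and> V.lincomb a B = v"
    using V.basis_criterion[of B] B v by blast
  show "coordinates class_ring V B v \<in> B \<rightarrow>\<^sub>E UNIV"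
    and "(\<Oplus>\<^bsub>V\<^esub>b\<in>B. coordinates class_ring V B v b \<odot>\<^bsub>V\<^esub> b) = v"
    using theI'[OF ex] unfolding coordinates_def V.lincomb_def by auto
  show "a = coordinates class_ring V B v"
    if "a \<in> B \<rightarrow>\<^sub>E UNIV" "(\<Oplus>\<^bsub>V\<^esub>b\<in>B. a b \<odot>\<^bsub>V\<^esub> b) = v"
    unfolding coordinates_def using that
    by (intro the1_equality[OF ex, symmetric]) (auto simp: V.lincomb_def)
qed

lemma coordinates_linear:
  assumes B: "finite B" "V.basis B" and b: "b \<in> B"
  shows "v \<in> carrier V \<Longrightarrow> w \<in> carrier V \<Longrightarrow> coordinates class_ring V B (v \<oplus>\<^bsub>V\<^esub> w) b =
      coordinates class_ring V B v b + coordinates class_ring V B w b"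
    and "v \<in> carrier V \<Longrightarrow>
      coordinates class_ring V B (c \<odot>\<^bsub>V\<^esub> v) b = c * coordinates class_ring V B v b"
proof -
  let ?q = "coordinates class_ring V B"
  have BV: "b \<in> carrier V" if "b \<in> B" for b using B V.basis_def that by auto
  note q = coordinates_basis(2)[OF B] and uniq = coordinates_basis(3)[OF B]
  show "?q (v \<oplus>\<^bsub>V\<^esub> w) b = ?q v b + ?q w b" if vw: "v \<in> carrier V" "w \<in> carrier V"
  proof -
    have "(\<Oplus>\<^bsub>V\<^esub>b\<in>B. restrict (\<lambda>b. ?q v b + ?q w b) B b \<odot>\<^bsub>V\<^esub> b) =
        (\<Oplus>\<^bsub>V\<^esub>b\<in>B. ?q v b \<odot>\<^bsub>V\<^esub> b \<oplus>\<^bsub>V\<^esub> ?q w b \<odot>\<^bsub>V\<^esub> b)"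
      using BV V.smult_l_distr by (intro V.finsum_cong') (auto intro!: V.smult_closed V.a_closed)
    also have "\<dots> = v \<oplus>\<^bsub>V\<^esub> w"
      using BV vw q by (subst V.finsum_addf) (auto intro!: V.smult_closed)
    finally have "restrict (\<lambda>b. ?q v b + ?q w b) B = ?q (v \<oplus>\<^bsub>V\<^esub> w)"
      using vw by (intro uniq) auto
    from this[symmetric] show ?thesis using b by simp
  qed
  show "?q (c \<odot>\<^bsub>V\<^esub> v) b = c * ?q v b" if v: "v \<in> carrier V"
  proof -
    have "(\<Oplus>\<^bsub>V\<^esub>b\<in>B. restrict (\<lambda>b. c * ?q v b) B b \<odot>\<^bsub>V\<^esub> b) =
        (\<Oplus>\<^bsub>V\<^esub>b\<in>B. c \<odot>\<^bsub>V\<^esub> (?q v b \<odot>\<^bsub>V\<^esub> b))"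
      using BV V.smult_assoc1 by (intro V.finsum_cong') (auto intro!: V.smult_closed)
    also have "\<dots> = c \<odot>\<^bsub>V\<^esub> (\<Oplus>\<^bsub>V\<^esub>b\<in>B. ?q v b \<odot>\<^bsub>V\<^esub> b)"
      using BV B by (intro V.finsum_smult[symmetric]) (auto intro!: V.smult_closed)
    also have "\<dots> = c \<odot>\<^bsub>V\<^esub> v" using q v by simp
    finally have "restrict (\<lambda>b. c * ?q v b) B = ?q (c \<odot>\<^bsub>V\<^esub> v)"
      using v by (intro uniq) (auto intro!: V.smult_closed)
    from this[symmetric] show ?thesis using b by simp
  qed
qed

text \<open>
  With \<open>q\<^sub>b\<close> the coordinates of a basis \<open>B\<close>, expanding \<open>b = \<Sum>\<^sub>i \<psi>\<^sub>i(b) e\<^sub>i\<close> in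
  \<open>\<Sum>\<^sub>b q\<^sub>b(T b)\<close> and expanding \<open>T e\<^sub>i = \<Sum>\<^sub>b q\<^sub>b(T e\<^sub>i) b\<close> in \<open>\<Sum>\<^sub>i \<psi>\<^sub>i(T e\<^sub>i)\<close>
  gives the same double sum. This settles at once that the choice of the basis does not matter and
  that the trace can be read off from any concrete spanning family.
\<close>

lemma trace_on_frame:
  assumes fin: "finite S" and e: "\<And>i. i \<in> S \<Longrightarrow> e i \<in> carrier V"
    and add: "\<And>i v w. i \<in> S \<Longrightarrow> v \<in> carrier V \<Longrightarrow> w \<in> carrier V \<Longrightarrow>
      \<psi> i (v \<oplus>\<^bsub>V\<^esub> w) = \<psi> i v + \<psi> i w"
    and scale: "\<And>i c v. i \<in> S \<Longrightarrow> v \<in> carrier V \<Longrightarrow> \<psi> i (c \<odot>\<^bsub>V\<^esub> v) = c * \<psi> i v"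
    and frame: "\<And>v. v \<in> carrier V \<Longrightarrow> (\<Oplus>\<^bsub>V\<^esub>i\<in>S. \<psi> i v \<odot>\<^bsub>V\<^esub> e i) = v"
    and T: "T \<in> module_hom class_ring V V"
  shows "trace_on class_ring V T = (\<Sum>i\<in>S. \<psi> i (T (e i)))"
proof -
  have Tc: "T v \<in> carrier V" if "v \<in> carrier V" for v
    using T that by (auto simp: module_hom_def)
  have Tadd: "T (v \<oplus>\<^bsub>V\<^esub> w) = T v \<oplus>\<^bsub>V\<^esub> T w" if "v \<in> carrier V" "w \<in> carrier V" for v w
    using T that by (auto simp: module_hom_def)
  have Tscale: "T (c \<odot>\<^bsub>V\<^esub> v) = c \<odot>\<^bsub>V\<^esub> T v" if "v \<in> carrier V" for c v
    using T that by (auto simp: module_hom_def)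
  \<comment> \<open>The trace is only specified in finite dimension; the frame is a finite spanning set.\<close>
  have "V.span (e ` S) = carrier V"
  proof -
    have "v \<in> V.span (e ` S)" if v: "v \<in> carrier V" for v
    proof -
      have "(\<Oplus>\<^bsub>V\<^esub>i\<in>A. c i \<odot>\<^bsub>V\<^esub> e i) \<in> V.span (e ` S)" if "A \<subseteq> S" for A c
        using finite_subset[OF that fin] that
      proof (induction A)
        case empty
        then show ?case using e V.span_is_submodule[of "e ` S"]
          by (auto simp: submodule_def)
      next
        case (insert i A)
        have "e i \<in> V.span (e ` S)"
          using insert.prems e V.in_own_span[of "e ` S"] by auto
        moreover have "submodule class_ring (V.span (e ` S)) V"
          using e by (intro V.span_is_submodule) auto
        ultimately have "c i \<odot>\<^bsub>V\<^esub> e i \<in> V.span (e ` S)" by (simp add: submodule_def)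
        with insert \<open>submodule _ _ _\<close> show ?case
          using e by (subst V.finsum_insert) (auto simp: submodule_def intro!: V.smult_closed)
      qed
      from this[of S "\<lambda>i. \<psi> i v"] frame[OF v] show ?thesis by simp
    qed
    then show ?thesis using e V.span_is_subset2[of "e ` S"] by auto
  qed
  then have "V.fin_dim" using fin e unfolding V.fin_dim_def by (intro exI[of _ "e ` S"]) auto
  then have ex: "\<exists>B. finite B \<and> V.basis B" by (rule V.finite_basis_exists)
  define B where "B = (SOME B. finite B \<and> V.basis B)"
  have B: "finite B" "V.basis B" using someI_ex[OF ex] unfolding B_def by auto
  have BV: "b \<in> carrier V" if "b \<in> B" for b using B V.basis_def that by auto
  let ?q = "coordinates class_ring V B"
  have "?q (T b) b = (\<Sum>i\<in>S. \<psi> i b * ?q (T (e i)) b)" if b: "b \<in> B" for b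
  proof -
    have "?q (T (\<Oplus>\<^bsub>V\<^esub>i\<in>S. \<psi> i b \<odot>\<^bsub>V\<^esub> e i)) b = (\<Sum>i\<in>S. \<psi> i b * ?q (T (e i)) b)"
      using e Tc by (intro linear_finsum[where \<phi> = "\<lambda>v. ?q (T v) b"])
        (auto simp: Tadd Tscale coordinates_linear[OF B b])
    then show ?thesis using frame[of b] BV[OF b] by simp
  qed
  moreover have "\<psi> i (T (e i)) = (\<Sum>b\<in>B. ?q (T (e i)) b * \<psi> i b)" if i: "i \<in> S" for i
  proof -
    have "\<psi> i (\<Oplus>\<^bsub>V\<^esub>b\<in>B. ?q (T (e i)) b \<odot>\<^bsub>V\<^esub> b) = (\<Sum>b\<in>B. ?q (T (e i)) b * \<psi> i b)"
      using BV i by (intro linear_finsum[where e = "\<lambda>b. b"]) (auto simp: add scale)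
    then show ?thesis using coordinates_basis(2)[OF B Tc[OF e[OF i]]] by simp
  qed
  ultimately have "(\<Sum>b\<in>B. ?q (T b) b) = (\<Sum>i\<in>S. \<psi> i (T (e i)))"
    by (simp add: sum.swap[of _ B S] mult.commute)
  then show ?thesis
    unfolding trace_on_def B_def[symmetric] Let_def by (simp add: class_ring_simps)
qed

end

section \<open>Induction over monomials\<close>

lemma poly_mapping_single_add_induct [case_names zero single add]:
  fixes p :: "'k \<Rightarrow>\<^sub>0 'b::comm_monoid_add"
  assumes "P 0" and "\<And>w c. w \<in> Poly_Mapping.keys p \<Longrightarrow> P (Poly_Mapping.single w c)"
    and "\<And>q r. P q \<Longrightarrow> P r \<Longrightarrow> P (q + r)"
  shows "P p"
proof -
  have "p = (\<Sum>w\<in>Poly_Mapping.keys p. Poly_Mapping.single w (Poly_Mapping.lookup p w))"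
    by (rule poly_mapping_eqI)
      (auto simp: lookup_sum lookup_single when_def in_keys_iff sum.delta' intro: sum.neutral)
  moreover have "P (\<Sum>w\<in>A. Poly_Mapping.single w (Poly_Mapping.lookup p w))"
    if "A \<subseteq> Poly_Mapping.keys p" for A
    using finite_subset[OF that finite_keys] that by induction (use assms in auto)
  ultimately show ?thesis by (metis order_refl)
qed

lemma single_mult_single_list:
  "Poly_Mapping.single u a * Poly_Mapping.single v b = Poly_Mapping.single (u @ v) (a * b)"
  by (simp add: mult_single plus_list_def)

section \<open>Coefficients summed over the listings of a set\<close>

text \<open>
  For finite \<open>M\<close> this is the coefficient of the square-free monomial \<open>\<Prod>M\<close> after all letters
  have been made to commute. An infinite set has no listing, so the value is 0 there.
\<close>

definition set_coeff :: "'x set \<Rightarrow> ('x list \<Rightarrow>\<^sub>0 'a::field) \<Rightarrow> 'a" where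
  "set_coeff M p = (\<Sum>w\<in>permutations_of_set M. Poly_Mapping.lookup p w)"

lemma set_coeff_zero [simp]: "set_coeff M 0 = 0"
  by (simp add: set_coeff_def)

lemma set_coeff_add [simp]: "set_coeff M (p + q) = set_coeff M p + set_coeff M q"
  by (simp add: set_coeff_def lookup_add sum.distrib)

lemma set_coeff_diff [simp]: "set_coeff M (p - q) = set_coeff M p - set_coeff M q"
  by (simp add: set_coeff_def lookup_minus sum_subtractf)

lemma set_coeff_sum: "set_coeff M (\<Sum>i\<in>A. f i) = (\<Sum>i\<in>A. set_coeff M (f i))"
  by (induction A rule: infinite_finite_induct) auto

lemma set_coeff_single:
  "set_coeff M (Poly_Mapping.single w c) = (if distinct w \<and> set w = M then c else 0)"
proof -
  have "set_coeff M (Poly_Mapping.single w c) = (\<Sum>v\<in>permutations_of_set M. if v = w then c else 0)"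
    unfolding set_coeff_def by (intro sum.cong) (auto simp: lookup_single when_def)
  then show ?thesis by (simp add: sum.delta') (auto simp: permutations_of_set_def)
qed

text \<open>
  A listing of \<open>M\<close> that ends in \<open>v\<close> is a listing of the remaining letters followed by \<open>v\<close>. This
  recursion is what turns the common kernels of the functionals into ideals.
\<close>

lemma set_coeff_mult_single:
  "set_coeff M (p * Poly_Mapping.single v c) =
    (if distinct v \<and> set v \<subseteq> M then set_coeff (M - set v) p * c else 0)"
proof (induction p rule: poly_mapping_single_add_induct)
  case (single w d)
  have "distinct (w @ v) \<and> set (w @ v) = M \<longleftrightarrow>
      distinct v \<and> set v \<subseteq> M \<and> distinct w \<and> set w = M - set v"
    by auto
  then show ?case by (simp only: single_mult_single_list set_coeff_single) auto
qed (auto simp: distrib_right)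

lemma set_coeff_single_mult:
  "set_coeff M (Poly_Mapping.single v c * p) =
    (if distinct v \<and> set v \<subseteq> M then c * set_coeff (M - set v) p else 0)"
proof (induction p rule: poly_mapping_single_add_induct)
  case (single w d)
  have "distinct (v @ w) \<and> set (v @ w) = M \<longleftrightarrow>
      distinct v \<and> set v \<subseteq> M \<and> distinct w \<and> set w = M - set v"
    by auto
  then show ?case by (simp only: single_mult_single_list set_coeff_single) auto
qed (auto simp: distrib_left)

section \<open>Free algebras\<close>

lemma free_algebra_simps:
  "carrier (free_algebra X) = {p. \<forall>w \<in> Poly_Mapping.keys p. set w \<subseteq> X}"
  "x \<otimes>\<^bsub>free_algebra X\<^esub> y = x * y" "x \<oplus>\<^bsub>free_algebra X\<^esub> y = x + y"
  "\<one>\<^bsub>free_algebra X\<^esub> = 1" "\<zero>\<^bsub>free_algebra X\<^esub> = 0"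
  "c \<odot>\<^bsub>free_algebra X\<^esub> x = Poly_Mapping.single [] c * x"
  by (simp_all add: free_algebra_def)

lemma single_in_free_algebra [simp]:
  "set w \<subseteq> X \<Longrightarrow> Poly_Mapping.single w c \<in> carrier (free_algebra X)"
  by (auto simp: free_algebra_simps)

lemma free_algebra_ring: "ring (free_algebra X :: ('a::field, 'x list \<Rightarrow>\<^sub>0 'a) module)"
proof (rule ringI)
  let ?C = "carrier (free_algebra X :: ('a, 'x list \<Rightarrow>\<^sub>0 'a) module)"
  have add: "p + q \<in> ?C" if "p \<in> ?C" "q \<in> ?C" for p q
    using that Poly_Mapping.keys_add[of p q] by (auto simp: free_algebra_simps)
  have neg: "- p \<in> ?C" if "p \<in> ?C" for p
    using that by (auto simp: free_algebra_simps)
  have mult: "p * q \<in> ?C" if "p \<in> ?C" "q \<in> ?C" for p q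
    using that keys_mult[of p q] by (fastforce simp: free_algebra_simps plus_list_def)
  have zero: "0 \<in> ?C"
    by (simp add: free_algebra_simps)
  have one: "1 \<in> ?C"
    unfolding single_one[symmetric] by (simp add: zero_list_def del: single_one)
  show "abelian_group (free_algebra X :: ('a, 'x list \<Rightarrow>\<^sub>0 'a) module)"
  proof (rule abelian_groupI, goal_cases)
    case (6 p)
    then show ?case using neg[of p] by (intro bexI[of _ "- p"]) (simp_all add: free_algebra_simps(2-))
  qed (simp_all add: add zero free_algebra_simps(2-) ac_simps)
  show "Group.monoid (free_algebra X :: ('a, 'x list \<Rightarrow>\<^sub>0 'a) module)"
    by (rule monoidI) (simp_all add: mult one free_algebra_simps(2-) mult.assoc)
qed (simp_all add: free_algebra_simps(2-) distrib_left distrib_right)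

lemma free_algebra_single_induct [consumes 1, case_names zero single add]:
  assumes "p \<in> carrier (free_algebra X)" "P 0"
    and "\<And>w c. set w \<subseteq> X \<Longrightarrow> P (Poly_Mapping.single w c)"
    and "\<And>q r. P q \<Longrightarrow> P r \<Longrightarrow> P (q + r)"
  shows "P p"
proof (rule poly_mapping_single_add_induct[where P = P])
  show "P (Poly_Mapping.single w c)" if "w \<in> Poly_Mapping.keys p" for w c
    using assms(1) that by (intro assms(3)) (auto simp: free_algebra_simps)
qed (fact assms)+

section \<open>Quotients by commutations and vanishing products\<close>

text \<open>
  An alphabet with a conflict relation: conflicting letters (in particular each letter with itself)
  multiply to zero, the other pairs commute. The relators are described up to the sign of the
  commutators, so that each unordered pair has to be listed only once.
\<close>

locale conflict_algebra =
  fixes X :: "'x set" and conflict :: "'x \<Rightarrow> 'x \<Rightarrow> bool" and R :: "('x list \<Rightarrow>\<^sub>0 'a::field) set"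
  assumes finite_X: "finite X"
    and conflict_refl: "conflict a a"
    and conflict_sym: "conflict a b \<Longrightarrow> conflict b a"
    and relators: "r \<in> R \<Longrightarrow> \<exists>a\<in>X. \<exists>b\<in>X.
      conflict a b \<and> r = Poly_Mapping.single [a, b] 1 \<or>
      r = Poly_Mapping.single [a, b] 1 - Poly_Mapping.single [b, a] 1"
    and vanishing_relator: "a \<in> X \<Longrightarrow> b \<in> X \<Longrightarrow> conflict a b \<Longrightarrow> Poly_Mapping.single [a, b] 1 \<in> R"
    and commuting_relator: "a \<in> X \<Longrightarrow> b \<in> X \<Longrightarrow> \<not> conflict a b \<Longrightarrow>
      Poly_Mapping.single [a, b] 1 - Poly_Mapping.single [b, a] 1 \<in> R \<or>
      Poly_Mapping.single [b, a] 1 - Poly_Mapping.single [a, b] 1 \<in> R"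
begin

abbreviation A :: "('a, 'x list \<Rightarrow>\<^sub>0 'a) module" where
  "A \<equiv> free_algebra X"

abbreviation I :: "('x list \<Rightarrow>\<^sub>0 'a) set" where
  "I \<equiv> genideal A R"

definition independent :: "'x set \<Rightarrow> bool" where
  "independent M \<longleftrightarrow> M \<subseteq> X \<and> pairwise (\<lambda>a b. \<not> conflict a b) M"

text \<open>
  A representative of the product of the letters of \<open>M\<close>, in an arbitrarily chosen order.
\<close>

definition set_monomial :: "'x set \<Rightarrow> 'x list \<Rightarrow>\<^sub>0 'a" where
  "set_monomial M = Poly_Mapping.single (SOME w. distinct w \<and> set w = M) 1"

lemma finite_independent: "finite {M. independent M}"
  by (rule finite_subset[OF _ finite_Pow_iff[THEN iffD2, OF finite_X]]) (auto simp: independent_def)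

lemma listing_exists:
  assumes "independent M"
  shows "distinct (SOME w. distinct w \<and> set w = M)" "set (SOME w. distinct w \<and> set w = M) = M"
proof -
  have "finite M" using assms finite_X finite_subset by (auto simp: independent_def)
  then have "\<exists>w. distinct w \<and> set w = M" using finite_distinct_list by blast
  from someI_ex[OF this]
  show "distinct (SOME w. distinct w \<and> set w = M)" "set (SOME w. distinct w \<and> set w = M) = M"
    by auto
qed

lemma set_coeff_set_monomial:
  "independent M \<Longrightarrow> set_coeff N (set_monomial M) = (if M = N then 1 else 0)"
  by (simp add: set_monomial_def set_coeff_single listing_exists)

lemma R_subset: "R \<subseteq> carrier A"
proof
  fix r assume "r \<in> R"
  from relators[OF this] obtain a b where ab: "a \<in> X" "b \<in> X" and
    r: "r = Poly_Mapping.single [a, b] 1 \<or>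
      r = Poly_Mapping.single [a, b] 1 - Poly_Mapping.single [b, a] 1"
    by blast
  have "Poly_Mapping.keys r \<subseteq> {[a, b], [b, a]}"
    using r by (auto simp: in_keys_iff lookup_minus lookup_single when_def split: if_splits)
  then show "r \<in> carrier A" using ab by (auto simp: free_algebra_simps)
qed

lemma ideal_I: "ideal I A"
  by (rule ring.genideal_ideal[OF free_algebra_ring R_subset])

lemma R_in_I: "r \<in> R \<Longrightarrow> r \<in> I"
  using ring.genideal_self[OF free_algebra_ring R_subset] by blast

lemma I_zero: "0 \<in> I"
  using additive_subgroup.zero_closed[OF ideal.axioms(1)[OF ideal_I]] by (simp add: free_algebra_simps)

lemma I_add: "p \<in> I \<Longrightarrow> q \<in> I \<Longrightarrow> p + q \<in> I"
  using additive_subgroup.a_closed[OF ideal.axioms(1)[OF ideal_I]] by (simp add: free_algebra_simps)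

lemma I_mult:
  assumes "p \<in> I"
  shows "q \<in> carrier A \<Longrightarrow> q * p \<in> I" "q \<in> carrier A \<Longrightarrow> p * q \<in> I"
  using ideal.I_l_closed[OF ideal_I assms, of q] ideal.I_r_closed[OF ideal_I assms, of q]
  by (simp_all add: free_algebra_simps)

lemma I_scale: "p \<in> I \<Longrightarrow> Poly_Mapping.single [] c * p \<in> I"
  by (rule I_mult) auto

lemma single_uminus_one: "Poly_Mapping.single [] (- 1) * p = - (p :: 'x list \<Rightarrow>\<^sub>0 'a)"
proof -
  have "Poly_Mapping.single [] (- 1) = (- 1 :: 'x list \<Rightarrow>\<^sub>0 'a)"
    by (metis single_one single_uminus zero_list_def)
  then show ?thesis by simp
qed

lemma I_uminus: "p \<in> I \<Longrightarrow> - p \<in> I"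
  using I_scale[of p "- 1"] by (simp add: single_uminus_one)

subsection \<open>Normal forms of words\<close>

lemma commutator_in_I:
  assumes "a \<in> X" "b \<in> X" "\<not> conflict a b"
  shows "Poly_Mapping.single [a, b] 1 - Poly_Mapping.single [b, a] 1 \<in> I"
  using commuting_relator[OF assms] R_in_I I_uminus by fastforce

lemma commute_past_word:
  assumes "a \<in> X" "set u \<subseteq> X" "\<forall>b\<in>set u. \<not> conflict a b"
  shows "Poly_Mapping.single (a # u) 1 - Poly_Mapping.single (u @ [a]) 1 \<in> I"
  using assms(2,3)
proof (induction u)
  case (Cons b u)
  have "Poly_Mapping.single (a # b # u) 1 - Poly_Mapping.single ((b # u) @ [a]) 1 =
      (Poly_Mapping.single [a, b] 1 - Poly_Mapping.single [b, a] 1) * Poly_Mapping.single u 1 +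
      Poly_Mapping.single [b] 1 *
        (Poly_Mapping.single (a # u) 1 - Poly_Mapping.single (u @ [a]) (1 :: 'a))"
    by (simp add: left_diff_distrib right_diff_distrib single_mult_single_list)
  also have "\<dots> \<in> I"
    using Cons assms(1) by (intro I_add I_mult commutator_in_I Cons.IH) auto
  finally show ?case .
qed (simp add: I_zero)

text \<open>
  The letters of a conflict-free word commute pairwise, so the first letter can be carried to its
  place in the other arrangement and the rest is handled by induction.
\<close>

lemma permute_word:
  assumes "sorted_wrt (\<lambda>a b. \<not> conflict a b) w" "set w \<subseteq> X" "mset w' = mset w"
  shows "Poly_Mapping.single w 1 - Poly_Mapping.single w' 1 \<in> I"
  using assms
proof (induction w arbitrary: w')
  case (Cons a u)
  have "a \<in> set w'" using Cons.prems(3) by (metis list.set_intros(1) set_mset_mset)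
  then obtain u1 u2 where w': "w' = u1 @ a # u2" by (meson split_list)
  have mset: "mset (u1 @ u2) = mset u" using Cons.prems(3) w' by simp
  then have "set u1 \<union> set u2 = set u" by (metis set_append set_mset_mset)
  then have set: "set u1 \<subseteq> set u" "set u2 \<subseteq> set u" by auto
  have "Poly_Mapping.single (a # u) 1 - Poly_Mapping.single w' 1 =
      Poly_Mapping.single [a] 1 *
        (Poly_Mapping.single u 1 - Poly_Mapping.single (u1 @ u2) (1 :: 'a)) +
      (Poly_Mapping.single (a # u1) 1 - Poly_Mapping.single (u1 @ [a]) 1) *
        Poly_Mapping.single u2 1"
    by (simp add: w' left_diff_distrib right_diff_distrib single_mult_single_list)
  also have "\<dots> \<in> I"
    using Cons.prems set
    by (intro I_add I_mult(1)[OF Cons.IH[OF _ _ mset]] I_mult(2)[OF commute_past_word]) (auto dest: subsetD)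
  finally show ?case .
qed (simp add: I_zero)

text \<open>
  Take a letter \<open>a\<close> whose remaining word is conflict-free and the first later letter \<open>b\<close> in conflict
  with it. Everything between them commutes with \<open>a\<close>, so \<open>a\<close> can be moved next to \<open>b\<close>, where the
  product vanishes.
\<close>

lemma conflicting_word:
  assumes "\<not> sorted_wrt (\<lambda>a b. \<not> conflict a b) w" "set w \<subseteq> X"
  shows "Poly_Mapping.single w 1 \<in> I"
  using assms
proof (induction w)
  case (Cons a w)
  show ?case
  proof (cases "sorted_wrt (\<lambda>a b. \<not> conflict a b) w")
    case False
    then have "Poly_Mapping.single [a] 1 * Poly_Mapping.single w (1 :: 'a) \<in> I"
      using Cons by (intro I_mult Cons.IH) auto
    then show ?thesis by (simp add: single_mult_single_list)
  next
    case True
    then have "\<exists>b\<in>set w. conflict a b" using Cons.prems by auto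
    from split_list_first_prop[OF this] obtain v b z
      where w: "w = v @ b # z" and ab: "conflict a b" and v: "\<forall>c\<in>set v. \<not> conflict a c" by blast
    have "Poly_Mapping.single (a # w) 1 =
        (Poly_Mapping.single (a # v) 1 - Poly_Mapping.single (v @ [a]) 1) *
          Poly_Mapping.single (b # z) 1 +
        Poly_Mapping.single v 1 *
          (Poly_Mapping.single [a, b] 1 * Poly_Mapping.single z (1 :: 'a))"
      by (simp add: w left_diff_distrib single_mult_single_list)
    also have "\<dots> \<in> I"
      using Cons.prems w v ab
      by (intro I_add I_mult commute_past_word R_in_I[OF vanishing_relator]) auto
    finally show ?thesis .
  qed
qed simp

lemma sorted_wrt_no_conflict:
  "sorted_wrt (\<lambda>a b. \<not> conflict a b) w \<longleftrightarrow> distinct w \<and> pairwise (\<lambda>a b. \<not> conflict a b) (set w)"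
  by (induction w) (use conflict_refl conflict_sym in \<open>auto simp: pairwise_insert\<close>)

subsection \<open>The ideal as a common kernel\<close>

text \<open>
  The common kernel \<open>J\<close> of the functionals of independent sets is a two-sided ideal, because
  multiplying by a word turns the functional of \<open>M\<close> into that of a subset of \<open>M\<close>, which is
  independent as well. It contains the relators: a conflicting pair of letters lists no independent
  set, and \<open>ab\<close> and \<open>ba\<close> list the same set.
\<close>

lemma set_coeff_I:
  assumes "p \<in> I" "independent M"
  shows "set_coeff M p = 0"
proof -
  define J where "J = {p \<in> carrier A. \<forall>M. independent M \<longrightarrow> set_coeff M p = 0}"
  interpret A: ring A by (rule free_algebra_ring)
  have sub: "independent (M - N)" if "independent M" for M N
    using that by (auto simp: independent_def pairwise_def)
  have J_l: "q * p \<in> J" if "q \<in> carrier A" "p \<in> J" for p q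
    using that(1)
  proof (induction q rule: free_algebra_single_induct)
    case zero
    then show ?case by (simp add: J_def free_algebra_simps)
  next
    case (single w c)
    moreover have "Poly_Mapping.single w c * p \<in> carrier A"
      using A.m_closed[of "Poly_Mapping.single w c" p] single that
      by (simp add: J_def free_algebra_simps(2))
    ultimately show ?case
      using that sub by (auto simp: J_def set_coeff_single_mult)
  next
    case (add q r)
    then show ?case
      using A.a_closed[of "q * p" "r * p"] by (simp add: J_def distrib_right free_algebra_simps(3))
  qed
  have J_r: "p * q \<in> J" if "q \<in> carrier A" "p \<in> J" for p q
    using that(1)
  proof (induction q rule: free_algebra_single_induct)
    case zero
    then show ?case by (simp add: J_def free_algebra_simps)
  next
    case (single w c)
    moreover have "p * Poly_Mapping.single w c \<in> carrier A"
      using A.m_closed[of p "Poly_Mapping.single w c"] single that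
      by (simp add: J_def free_algebra_simps(2))
    ultimately show ?case
      using that sub by (auto simp: J_def set_coeff_mult_single)
  next
    case (add q r)
    then show ?case
      using A.a_closed[of "p * q" "p * r"] by (simp add: J_def distrib_left free_algebra_simps(3))
  qed
  have "ideal J A"
  proof (rule idealI)
    show "ring A" by (rule free_algebra_ring)
    show "subgroup J (add_monoid A)"
    proof (rule group.subgroupI)
      show "group (add_monoid A)" by (rule A.a_group)
      show "J \<subseteq> carrier (add_monoid A)" by (auto simp: J_def)
      have "0 \<in> J" by (simp add: J_def free_algebra_simps)
      then show "J \<noteq> {}" by auto
      show "inv\<^bsub>add_monoid A\<^esub> p \<in> J" if "p \<in> J" for p
      proof -
        have "Poly_Mapping.single [] (- 1) * p \<in> J" using that by (intro J_l) auto
        then have "- p \<in> J" by (simp add: single_uminus_one)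
        moreover from this have "inv\<^bsub>add_monoid A\<^esub> p = - p"
          using that A.minus_equality[of "- p" p, unfolded a_inv_def]
          by (simp add: J_def free_algebra_simps(3,5))
        ultimately show ?thesis by simp
      qed
      show "p \<otimes>\<^bsub>add_monoid A\<^esub> q \<in> J" if "p \<in> J" "q \<in> J" for p q
        using that A.a_closed[of p q] by (auto simp: J_def free_algebra_simps(3))
    qed
  qed (use J_l J_r in \<open>simp_all add: free_algebra_simps(2)\<close>)
  moreover have "R \<subseteq> J"
  proof
    fix r assume r: "r \<in> R"
    have "set_coeff M r = 0" if M: "independent M" for M
    proof -
      obtain a b where ab: "conflict a b \<and> r = Poly_Mapping.single [a, b] 1 \<or>
          r = Poly_Mapping.single [a, b] 1 - Poly_Mapping.single [b, a] 1"
        using relators[OF r] by blast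
      then show ?thesis
        using M by (auto simp: set_coeff_single independent_def pairwise_def)
    qed
    then show "r \<in> J" using R_subset r by (auto simp: J_def)
  qed
  ultimately have "I \<subseteq> J" by (rule A.genideal_minimal)
  then show ?thesis using assms by (auto simp: J_def)
qed

text \<open>
  Every element reduces modulo the ideal to the combination of the monomials of independent sets
  whose coefficients are the values of the functionals; by linearity only words need to be reduced.
\<close>

lemma normal_form:
  assumes "p \<in> carrier A"
  shows "p - (\<Sum>M | independent M. Poly_Mapping.single [] (set_coeff M p) * set_monomial M) \<in> I"
    (is "p - ?N p \<in> I")
  using assms
proof (induction p rule: free_algebra_single_induct)
  case zero
  then show ?case using I_zero by simp
next
  case (single w c)
  have scale: "Poly_Mapping.single w c = Poly_Mapping.single [] c * Poly_Mapping.single w 1"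
    by (simp add: single_mult_single_list)
  show ?case
  proof (cases "sorted_wrt (\<lambda>a b. \<not> conflict a b) w")
    case True
    then have w: "distinct w" "independent (set w)"
      using single by (auto simp: sorted_wrt_no_conflict independent_def)
    have "?N (Poly_Mapping.single w c) = (\<Sum>M | independent M. if M = set w
        then Poly_Mapping.single [] c * set_monomial (set w) else 0)"
      using w by (intro sum.cong) (auto simp: set_coeff_single)
    also have "\<dots> = Poly_Mapping.single [] c * set_monomial (set w)"
      using w finite_independent by (subst sum.delta) auto
    finally have "Poly_Mapping.single w c - ?N (Poly_Mapping.single w c) =
        Poly_Mapping.single [] c * (Poly_Mapping.single w 1 - set_monomial (set w))"
      by (simp add: right_diff_distrib scale[symmetric])
    moreover have "mset (SOME v. distinct v \<and> set v = set w) = mset w"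
      using listing_exists[OF w(2)] w(1) by (metis set_eq_iff_mset_eq_distinct)
    then have "Poly_Mapping.single w 1 - set_monomial (set w) \<in> I"
      unfolding set_monomial_def by (rule permute_word[OF True single])
    ultimately show ?thesis using I_scale by simp
  next
    case False
    then have "set_coeff M (Poly_Mapping.single w c) = 0" if "independent M" for M
      using that by (auto simp: set_coeff_single sorted_wrt_no_conflict independent_def)
    then have "?N (Poly_Mapping.single w c) = 0" by (intro sum.neutral) auto
    then show ?thesis
      using conflicting_word[OF False single] I_scale scale by simp
  qed
next
  case (add p q)
  have "?N (p + q) = ?N p + ?N q"
    by (simp add: single_add distrib_right sum.distrib)
  with I_add[OF add] show ?case by (simp add: algebra_simps)
qed

lemma I_iff: "p \<in> carrier A \<Longrightarrow> p \<in> I \<longleftrightarrow> (\<forall>M. independent M \<longrightarrow> set_coeff M p = 0)"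
  using normal_form[of p] set_coeff_I[of p] by auto

subsection \<open>Graded pieces of the quotient\<close>

lemma coset_eq_iff:
  assumes "p \<in> carrier A" "q \<in> carrier A"
  shows "I +>\<^bsub>A\<^esub> p = I +>\<^bsub>A\<^esub> q \<longleftrightarrow> (\<forall>M. independent M \<longrightarrow> set_coeff M p = set_coeff M q)"
proof -
  interpret ideal I A by (rule ideal_I)
  have "p - q = p \<ominus>\<^bsub>A\<^esub> q"
    using minus_equality[of "- q" q] assms
    by (simp add: a_minus_def free_algebra_simps)
  then have "I +>\<^bsub>A\<^esub> p = I +>\<^bsub>A\<^esub> q \<longleftrightarrow> p - q \<in> I"
    using quotient_eq_iff_same_a_r_cos[OF ideal_I assms] by simp
  also have "p - q \<in> carrier A"
    using minus_closed[OF assms] \<open>p - q = _\<close> by simp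
  then have "p - q \<in> I \<longleftrightarrow> (\<forall>M. independent M \<longrightarrow> set_coeff M p = set_coeff M q)"
    by (simp add: I_iff)
  finally show ?thesis .
qed

lemma coset_self: "p \<in> carrier A \<Longrightarrow> p \<in> I +>\<^bsub>A\<^esub> p"
  by (rule abelian_subgroup.a_rcos_self[OF abelian_subgroupI3])
    (use ideal_I free_algebra_ring in \<open>auto simp: ideal_def ring_def\<close>)

lemma mem_coset:
  assumes "q \<in> I +>\<^bsub>A\<^esub> p" "p \<in> carrier A"
  shows "q \<in> carrier A" "I +>\<^bsub>A\<^esub> q = I +>\<^bsub>A\<^esub> p"
proof -
  interpret ideal I A by (rule ideal_I)
  show "q \<in> carrier A" using assms a_elemrcos_carrier by blast
  show "I +>\<^bsub>A\<^esub> q = I +>\<^bsub>A\<^esub> p"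
    by (rule a_repr_independence'[OF assms, symmetric])
qed

definition homogeneous :: "nat \<Rightarrow> ('x list \<Rightarrow>\<^sub>0 'a) set" where
  "homogeneous d = {p \<in> carrier A. \<forall>w \<in> Poly_Mapping.keys p. length w = d}"

text \<open>
  The degree part of the quotient algebra, with the same scalar multiplication through
  representatives that is used for the whole algebra of the cycle.
\<close>

definition graded_piece :: "nat \<Rightarrow> ('a, ('x list \<Rightarrow>\<^sub>0 'a) set) module" where
  "graded_piece d = ring.extend (A Quot I)
     (module.fields (\<lambda>c C. \<Union>p\<in>C. I +>\<^bsub>A\<^esub> (c \<odot>\<^bsub>A\<^esub> p)))
     \<lparr>carrier := (\<lambda>p. I +>\<^bsub>A\<^esub> p) ` homogeneous d\<rparr>"

lemma homogeneous_carrier: "p \<in> homogeneous d \<Longrightarrow> p \<in> carrier A"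
  by (simp add: homogeneous_def)

lemma homogeneous_zero: "0 \<in> homogeneous d"
  by (simp add: homogeneous_def free_algebra_simps)

lemma homogeneous_add: "p \<in> homogeneous d \<Longrightarrow> q \<in> homogeneous d \<Longrightarrow> p + q \<in> homogeneous d"
  using Poly_Mapping.keys_add[of p q] unfolding homogeneous_def free_algebra_simps(1) by blast

lemma homogeneous_scale: "p \<in> homogeneous d \<Longrightarrow> Poly_Mapping.single [] c * p \<in> homogeneous d"
proof -
  assume p: "p \<in> homogeneous d"
  have "Poly_Mapping.keys (Poly_Mapping.single [] c * p) \<subseteq> Poly_Mapping.keys p"
    using keys_mult[of "Poly_Mapping.single [] c" p] by (auto simp: plus_list_def split: if_splits)
  then show ?thesis using p unfolding homogeneous_def free_algebra_simps(1) by blast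
qed

lemma homogeneous_set_monomial:
  "independent M \<Longrightarrow> card M = d \<Longrightarrow> set_monomial M \<in> homogeneous d"
  using listing_exists[of M] distinct_card[of "SOME w. distinct w \<and> set w = M"]
  by (auto simp: homogeneous_def set_monomial_def independent_def)

lemma set_coeff_homogeneous:
  assumes "p \<in> homogeneous d" "card M \<noteq> d"
  shows "set_coeff M p = 0"
  unfolding set_coeff_def
proof (rule sum.neutral, rule ballI)
  fix w assume "w \<in> permutations_of_set M"
  then have "length w \<noteq> d" using assms(2) by (auto simp: permutations_of_set_def distinct_card)
  then show "Poly_Mapping.lookup p w = 0" using assms(1) by (auto simp: homogeneous_def in_keys_iff)
qed

lemma carrier_graded_piece: "carrier (graded_piece d) = (\<lambda>p. I +>\<^bsub>A\<^esub> p) ` homogeneous d"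
  by (simp add: graded_piece_def)

lemma zero_graded_piece: "\<zero>\<^bsub>graded_piece d\<^esub> = I +>\<^bsub>A\<^esub> 0"
proof -
  interpret ideal I A by (rule ideal_I)
  show ?thesis
    using a_coset_add_zero[of I] a_subset
    by (simp add: graded_piece_def ring.defs module.defs FactRing_def free_algebra_simps)
qed

lemma add_graded_piece:
  assumes "p \<in> carrier A" "q \<in> carrier A"
  shows "(I +>\<^bsub>A\<^esub> p) \<oplus>\<^bsub>graded_piece d\<^esub> (I +>\<^bsub>A\<^esub> q) = I +>\<^bsub>A\<^esub> (p + q)"
proof -
  interpret ideal I A by (rule ideal_I)
  show ?thesis
    using a_rcos_sum[OF assms]
    by (simp add: graded_piece_def ring.defs module.defs FactRing_def free_algebra_simps)
qed

lemma smult_graded_piece: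
  assumes "p \<in> carrier A"
  shows "c \<odot>\<^bsub>graded_piece d\<^esub> (I +>\<^bsub>A\<^esub> p) = I +>\<^bsub>A\<^esub> (Poly_Mapping.single [] c * p)"
proof -
  interpret ideal I A by (rule ideal_I)
  have closed: "Poly_Mapping.single [] c * q \<in> carrier A" if "q \<in> carrier A" for q
    using m_closed[of "Poly_Mapping.single [] c" q] that by (simp add: free_algebra_simps(2))
  have "I +>\<^bsub>A\<^esub> (Poly_Mapping.single [] c * q) = I +>\<^bsub>A\<^esub> (Poly_Mapping.single [] c * p)"
    if "q \<in> I +>\<^bsub>A\<^esub> p" for q
    using mem_coset[OF that assms] assms closed
    by (simp add: coset_eq_iff set_coeff_single_mult)
  then have "(\<Union>q\<in>I +>\<^bsub>A\<^esub> p. I +>\<^bsub>A\<^esub> (Poly_Mapping.single [] c * q)) =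
      I +>\<^bsub>A\<^esub> (Poly_Mapping.single [] c * p)"
    using coset_self[OF assms] by blast
  then show ?thesis
    by (simp add: graded_piece_def ring.defs module.defs free_algebra_simps(6))
qed

lemma graded_piece_vectorspace: "vectorspace class_ring (graded_piece d)"
proof -
  have "abelian_group (graded_piece d)"
  proof (rule abelian_groupI, goal_cases)
    case (6 C)
    then obtain p where p: "p \<in> homogeneous d" and C: "C = I +>\<^bsub>A\<^esub> p"
      by (auto simp: carrier_graded_piece)
    have "- p \<in> homogeneous d" using homogeneous_scale[OF p, of "- 1"] by (simp add: single_uminus_one)
    then show ?case
      using p by (intro bexI[of _ "I +>\<^bsub>A\<^esub> (- p)"])
        (simp_all add: C add_graded_piece homogeneous_carrier zero_graded_piece carrier_graded_piece)
  qed (auto simp: carrier_graded_piece add_graded_piece zero_graded_piece homogeneous_carrier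
      homogeneous_carrier[OF homogeneous_add] homogeneous_carrier[OF homogeneous_zero]
      homogeneous_add homogeneous_zero ac_simps)
  moreover have "Poly_Mapping.single [] (a + b) * p =
      Poly_Mapping.single [] a * p + Poly_Mapping.single [] b * (p :: 'x list \<Rightarrow>\<^sub>0 'a)" for a b p
    by (simp add: single_add distrib_right)
  moreover have "Poly_Mapping.single [] (a * b) * p =
      Poly_Mapping.single [] a * (Poly_Mapping.single [] b * (p :: 'x list \<Rightarrow>\<^sub>0 'a))" for a b p
    by (simp add: mult.assoc[symmetric] single_mult_single_list)
  moreover have "Poly_Mapping.single [] 1 * p = (p :: 'x list \<Rightarrow>\<^sub>0 'a)" for p
    using single_one by (metis mult_1 zero_list_def)
  ultimately have "Module.module class_ring (graded_piece d)"
    by (intro moduleI class_cring.is_cring)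
      (auto simp: carrier_graded_piece add_graded_piece smult_graded_piece distrib_left
        homogeneous_scale homogeneous_carrier homogeneous_carrier[OF homogeneous_scale]
        homogeneous_carrier[OF homogeneous_add])
  then show ?thesis by (intro vectorspace.intro class_field)
qed

lemma finsum_graded_piece:
  assumes "finite S" "\<And>M. M \<in> S \<Longrightarrow> independent M \<and> card M = d"
  shows "(\<Oplus>\<^bsub>graded_piece d\<^esub>M\<in>S. c M \<odot>\<^bsub>graded_piece d\<^esub> (I +>\<^bsub>A\<^esub> set_monomial M)) =
      I +>\<^bsub>A\<^esub> (\<Sum>M\<in>S. Poly_Mapping.single [] (c M) * set_monomial M)"
    and "(\<Sum>M\<in>S. Poly_Mapping.single [] (c M) * set_monomial M) \<in> homogeneous d"
proof -
  interpret V: vectorspace class_ring "graded_piece d" by (rule graded_piece_vectorspace)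
  let ?s = "\<lambda>S. \<Sum>M\<in>S. Poly_Mapping.single [] (c M) * set_monomial M"
  have hom: "?s S \<in> homogeneous d" if "finite S" "\<forall>M\<in>S. independent M \<and> card M = d" for S
    using that by (induction S)
      (auto intro!: homogeneous_add homogeneous_scale homogeneous_set_monomial homogeneous_zero)
  show "?s S \<in> homogeneous d" using hom assms by blast
  show "(\<Oplus>\<^bsub>graded_piece d\<^esub>M\<in>S. c M \<odot>\<^bsub>graded_piece d\<^esub> (I +>\<^bsub>A\<^esub> set_monomial M)) = I +>\<^bsub>A\<^esub> ?s S"
    using assms
  proof (induction S)
    case empty
    then show ?case by (simp add: zero_graded_piece)
  next
    case (insert M S)
    have "c N \<odot>\<^bsub>graded_piece d\<^esub> (I +>\<^bsub>A\<^esub> set_monomial N) \<in> carrier (graded_piece d)"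
      if "N \<in> insert M S" for N
      using insert.prems that
      by (simp add: smult_graded_piece homogeneous_carrier[OF homogeneous_set_monomial]
          carrier_graded_piece homogeneous_scale homogeneous_set_monomial)
    then have "(\<Oplus>\<^bsub>graded_piece d\<^esub>N\<in>insert M S. c N \<odot>\<^bsub>graded_piece d\<^esub> (I +>\<^bsub>A\<^esub> set_monomial N)) =
        c M \<odot>\<^bsub>graded_piece d\<^esub> (I +>\<^bsub>A\<^esub> set_monomial M) \<oplus>\<^bsub>graded_piece d\<^esub> (I +>\<^bsub>A\<^esub> ?s S)"
      using insert by (subst V.finsum_insert) auto
    also have "\<dots> = I +>\<^bsub>A\<^esub> (Poly_Mapping.single [] (c M) * set_monomial M + ?s S)"
      using insert.prems insert.hyps(1)
      by (simp add: smult_graded_piece homogeneous_carrier[OF homogeneous_set_monomial]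
          add_graded_piece homogeneous_carrier[OF homogeneous_scale[OF homogeneous_set_monomial]]
          homogeneous_carrier[OF hom])
    finally show ?case using insert by simp
  qed
qed

text \<open>
  The frame consists of the monomials of the independent sets of size \<open>d\<close>; the functionals are
  evaluated on cosets through arbitrary representatives. The endomorphism is assumed to be induced
  by a map on homogeneous elements of the free algebra.
\<close>

lemma trace_graded_piece:
  assumes t_hom: "\<And>p. p \<in> homogeneous d \<Longrightarrow> t p \<in> homogeneous d"
    and T: "\<And>p. p \<in> homogeneous d \<Longrightarrow> T (I +>\<^bsub>A\<^esub> p) = I +>\<^bsub>A\<^esub> t p"
    and t_add: "\<And>p q. p \<in> homogeneous d \<Longrightarrow> q \<in> homogeneous d \<Longrightarrow> t (p + q) = t p + t q"
    and t_scale: "\<And>c p. p \<in> homogeneous d \<Longrightarrow>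
      t (Poly_Mapping.single [] c * p) = Poly_Mapping.single [] c * t p"
  shows "trace_on class_ring (graded_piece d) T =
    (\<Sum>M | independent M \<and> card M = d. set_coeff M (t (set_monomial M)))"
proof -
  define \<psi> where "\<psi> M C = set_coeff M (SOME p. p \<in> C)" for M and C :: "('x list \<Rightarrow>\<^sub>0 'a) set"
  define S where "S = {M. independent M \<and> card M = d}"
  have fin: "finite S" unfolding S_def by (rule finite_subset[OF _ finite_independent]) auto
  have \<psi>: "\<psi> M (I +>\<^bsub>A\<^esub> p) = set_coeff M p" if "independent M" "p \<in> carrier A" for M p
  proof -
    have "(SOME q. q \<in> I +>\<^bsub>A\<^esub> p) \<in> I +>\<^bsub>A\<^esub> p" using coset_self[OF that(2)] by (rule someI)
    from mem_coset[OF this that(2)] show ?thesis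
      unfolding \<psi>_def using coset_eq_iff that by blast
  qed
  note hc = homogeneous_carrier
  have "trace_on class_ring (graded_piece d) T = (\<Sum>M\<in>S. \<psi> M (T (I +>\<^bsub>A\<^esub> set_monomial M)))"
  proof (rule trace_on_frame[OF graded_piece_vectorspace fin])
    show "I +>\<^bsub>A\<^esub> set_monomial M \<in> carrier (graded_piece d)" if "M \<in> S" for M
      using that by (simp add: S_def carrier_graded_piece homogeneous_set_monomial)
    show "\<psi> M (v \<oplus>\<^bsub>graded_piece d\<^esub> w) = \<psi> M v + \<psi> M w"
      if "M \<in> S" "v \<in> carrier (graded_piece d)" "w \<in> carrier (graded_piece d)" for M v w
      using that
      by (auto simp: S_def carrier_graded_piece add_graded_piece \<psi> hc hc[OF homogeneous_add])
    show "\<psi> M (c \<odot>\<^bsub>graded_piece d\<^esub> v) = c * \<psi> M v"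
      if "M \<in> S" "v \<in> carrier (graded_piece d)" for M c v
      using that
      by (auto simp: S_def carrier_graded_piece smult_graded_piece \<psi> hc hc[OF homogeneous_scale]
          set_coeff_single_mult)
    show "(\<Oplus>\<^bsub>graded_piece d\<^esub>M\<in>S. \<psi> M v \<odot>\<^bsub>graded_piece d\<^esub> (I +>\<^bsub>A\<^esub> set_monomial M)) = v"
      if v_mem: "v \<in> carrier (graded_piece d)" for v
    proof -
      obtain p where p: "p \<in> homogeneous d" and v: "v = I +>\<^bsub>A\<^esub> p"
        using v_mem by (auto simp: carrier_graded_piece)
      let ?s = "\<Sum>M\<in>S. Poly_Mapping.single [] (\<psi> M v) * set_monomial M"
      have "set_coeff N ?s = set_coeff N p" if N: "independent N" for N
      proof -
        have "set_coeff N ?s = (\<Sum>M\<in>S. if M = N then \<psi> N v else 0)"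
          unfolding set_coeff_sum
          by (intro sum.cong) (auto simp: S_def set_coeff_single_mult set_coeff_set_monomial)
        also have "\<dots> = (if N \<in> S then set_coeff N p else 0)"
          using fin N by (simp add: sum.delta v \<psi> hc[OF p])
        also have "\<dots> = set_coeff N p"
          using N set_coeff_homogeneous[OF p] by (auto simp: S_def)
        finally show ?thesis .
      qed
      moreover have "?s \<in> homogeneous d"
        using fin by (intro finsum_graded_piece) (auto simp: S_def)
      ultimately have "I +>\<^bsub>A\<^esub> ?s = v"
        using p by (simp add: v coset_eq_iff hc)
      moreover have "(\<Oplus>\<^bsub>graded_piece d\<^esub>M\<in>S. \<psi> M v \<odot>\<^bsub>graded_piece d\<^esub> (I +>\<^bsub>A\<^esub> set_monomial M)) =
          I +>\<^bsub>A\<^esub> ?s"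
        using fin by (intro finsum_graded_piece) (auto simp: S_def)
      ultimately show ?thesis by simp
    qed
    show "T \<in> module_hom class_ring (graded_piece d) (graded_piece d)"
      unfolding module_hom_def
      by (auto simp: carrier_graded_piece T t_hom add_graded_piece smult_graded_piece hc
          hc[OF t_hom] t_add t_scale homogeneous_add homogeneous_scale)
  qed
  also have "\<dots> = (\<Sum>M\<in>S. set_coeff M (t (set_monomial M)))"
    by (intro sum.cong)
      (auto simp: S_def T homogeneous_set_monomial \<psi> hc[OF t_hom])
  finally show ?thesis by (simp add: S_def)
qed

end

section \<open>The algebra of the cycle and its reflection\<close>

definition shares_vertex :: "nat \<times> nat \<Rightarrow> nat \<times> nat \<Rightarrow> bool" where
  "shares_vertex e f \<longleftrightarrow> {fst e, snd e} \<inter> {fst f, snd f} \<noteq> {}"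

lemma shares_vertex_simps [simp]:
  "shares_vertex (i, j) (k, l) \<longleftrightarrow> i = k \<or> i = l \<or> j = k \<or> j = l"
  by (auto simp: shares_vertex_def)

lemma cycle_letters_cases:
  assumes "e \<in> cycle_letters n"
  obtains (closing) "e = (1, n)" | (path) m where "1 \<le> m" "m \<le> n - 1" "e = (m, m + 1)"
  using assms by (auto simp: cycle_letters_def)

lemma gen_less: "i < j \<Longrightarrow> gen i j = Poly_Mapping.single [(i, j)] 1"
  by (simp add: gen_def)

lemma FK_conflict_algebra:
  assumes n: "n > 3"
  shows "conflict_algebra (cycle_letters n) shares_vertex
    (FK_relations n :: ((nat \<times> nat) list \<Rightarrow>\<^sub>0 'a::field) set)"
proof
  let ?R = "FK_relations n :: ((nat \<times> nat) list \<Rightarrow>\<^sub>0 'a) set"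
  let ?X = "cycle_letters n"
  have "?X \<subseteq> {..n + 1} \<times> {..n + 1}" by (auto simp: cycle_letters_def)
  then show "finite ?X" by (rule finite_subset) auto
  show "shares_vertex a a" for a by (simp add: shares_vertex_def)
  show "shares_vertex b a" if "shares_vertex a b" for a b
    using that by (auto simp: shares_vertex_def)
  have path: "(m, m + 1) \<in> ?X" if "1 \<le> m" "m \<le> n - 1" for m
    using that by (auto simp: cycle_letters_def)
  have closing: "(1, n) \<in> ?X" by (simp add: cycle_letters_def)
  have prod: "gen i j * gen k l = (Poly_Mapping.single [(i, j), (k, l)] 1 :: _ \<Rightarrow>\<^sub>0 'a)"
    if "i < j" "k < l" for i j k l
    using that by (simp add: gen_less single_mult_single_list)
  show "\<exists>a\<in>?X. \<exists>b\<in>?X. shares_vertex a b \<and> r = Poly_Mapping.single [a, b] 1 \<or>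
      r = Poly_Mapping.single [a, b] 1 - Poly_Mapping.single [b, a] 1" (is "?P r")
    if "r \<in> ?R" for r
  proof -
    have zero: "?P (gen i j * gen k l)"
      if "(i, j) \<in> ?X" "(k, l) \<in> ?X" "i < j" "k < l" "shares_vertex (i, j) (k, l)" for i j k l
      using that unfolding prod[OF that(3,4)] by blast
    have comm: "?P (gen i j * gen k l - gen k l * gen i j)"
      if "(i, j) \<in> ?X" "(k, l) \<in> ?X" "i < j" "k < l" for i j k l
      using that unfolding prod[OF that(3,4)] prod[OF that(4,3)] by blast
    have n_edge: "(n - 1, n) \<in> ?X" and one_edge: "(1, 2) \<in> ?X"
      using path[of "n - 1"] path[of 1] n by (simp_all add: numeral_2_eq_2)
    consider m where "1 \<le> m" "m \<le> n - 1" "r = gen m (m+1) * gen m (m+1)"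
      | "r = gen 1 n * gen 1 n"
      | m where "1 \<le> m" "m \<le> n - 2" "r = gen m (m+1) * gen (m+1) (m+2)"
      | m where "1 \<le> m" "m \<le> n - 2" "r = gen (m+1) (m+2) * gen m (m+1)"
      | "r \<in> {gen (n-1) n * gen 1 n, gen 1 n * gen (n-1) n, gen 1 2 * gen 1 n, gen 1 n * gen 1 2}"
      | m l where "1 \<le> m" "m \<le> l - 2" "3 \<le> l" "l \<le> n - 1"
        "r = gen m (m+1) * gen l (l+1) - gen l (l+1) * gen m (m+1)"
      | m where "2 \<le> m" "m \<le> n - 2" "r = gen m (m+1) * gen 1 n - gen 1 n * gen m (m+1)"
      using \<open>r \<in> ?R\<close> unfolding FK_relations_def by blast
    then show ?thesis
    proof cases
      case (1 m)
      then show ?thesis using path[of m] by (simp only:) (intro zero; simp)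
    next
      case 2
      then show ?thesis using closing n by (simp only:) (intro zero; simp)
    next
      case (3 m)
      then show ?thesis using path[of m] path[of "m + 1"] by (simp only:) (intro zero; simp)
    next
      case (4 m)
      then show ?thesis using path[of m] path[of "m + 1"] by (simp only:) (intro zero; simp)
    next
      case 5
      moreover have "?P (gen (n-1) n * gen 1 n)" "?P (gen 1 n * gen (n-1) n)"
        "?P (gen 1 2 * gen 1 n)" "?P (gen 1 n * gen 1 2)"
        using n_edge one_edge closing n by (intro zero; simp)+
      ultimately show ?thesis by (elim insertE emptyE) (simp only:)+
    next
      case (6 m l)
      then show ?thesis using path[of m] path[of l] by (simp only:) (intro comm; simp)
    next
      case (7 m)
      then show ?thesis using path[of m] closing n by (simp only:) (intro comm; simp)
    qed
  qed
  show "Poly_Mapping.single [a, b] 1 \<in> ?R"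
    if ab: "a \<in> ?X" "b \<in> ?X" "shares_vertex a b" for a b
  proof -
    have sq: "gen m (m+1) * gen m (m+1) \<in> ?R" if "1 \<le> m" "m \<le> n - 1" for m
      using that unfolding FK_relations_def by blast
    have up: "gen m (m+1) * gen (m+1) (m+2) \<in> ?R" if "1 \<le> m" "m \<le> n - 2" for m
      using that unfolding FK_relations_def by blast
    have down: "gen (m+1) (m+2) * gen m (m+1) \<in> ?R" if "1 \<le> m" "m \<le> n - 2" for m
      using that unfolding FK_relations_def by blast
    have cl: "gen 1 n * gen 1 n \<in> ?R" "gen (n-1) n * gen 1 n \<in> ?R" "gen 1 n * gen (n-1) n \<in> ?R"
      "gen 1 2 * gen 1 n \<in> ?R" "gen 1 n * gen 1 2 \<in> ?R"
      unfolding FK_relations_def by blast+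
    have n1: "n - 1 < n" "1 < n" "1 < (2::nat)" using n by auto
    note cl = cl[unfolded prod[OF n1(2,2)] prod[OF n1(1,2)] prod[OF n1(2,1)]
        prod[OF n1(3,2)] prod[OF n1(2,3)]]
    show ?thesis
      using ab(1)
    proof (cases rule: cycle_letters_cases)
      case closing
      note a = this
      show ?thesis using ab(2)
      proof (cases rule: cycle_letters_cases)
        case closing
        then show ?thesis using a cl by simp
      next
        case (path l)
        then have "l = 1 \<or> l = n - 1" using a ab(3) n by auto
        then show ?thesis using a path cl n by (auto simp: numeral_2_eq_2)
      qed
    next
      case (path m)
      note a = this
      show ?thesis using ab(2)
      proof (cases rule: cycle_letters_cases)
        case closing
        then have "m = 1 \<or> m = n - 1" using a ab(3) n by auto
        then show ?thesis using a closing cl n by (auto simp: numeral_2_eq_2)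
      next
        case (path l)
        then consider "l = m" | "l = m + 1" | "m = l + 1" using a ab(3) by auto
        then show ?thesis
        proof cases
          case 1
          then show ?thesis using sq[of m] a path by (simp add: prod)
        next
          case 2
          then show ?thesis using up[of m] a path by (simp add: prod)
        next
          case 3
          then show ?thesis using down[of l] a path by (simp add: prod)
        qed
      qed
    qed
  qed
  show "Poly_Mapping.single [a, b] 1 - Poly_Mapping.single [b, a] 1 \<in> ?R \<or>
      Poly_Mapping.single [b, a] 1 - Poly_Mapping.single [a, b] 1 \<in> ?R"
    if ab: "a \<in> ?X" "b \<in> ?X" "\<not> shares_vertex a b" for a b
  proof -
    have far: "Poly_Mapping.single [(m, m+1), (l, l+1)] 1 -
        Poly_Mapping.single [(l, l+1), (m, m+1)] 1 \<in> ?R"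
      if "1 \<le> m" "m + 2 \<le> l" "l \<le> n - 1" for m l
    proof -
      have "1 \<le> m \<and> m \<le> l - 2 \<and> 3 \<le> l \<and> l \<le> n - 1" using that by auto
      then have "gen m (m+1) * gen l (l+1) - gen l (l+1) * gen m (m+1) \<in> ?R"
        unfolding FK_relations_def by blast
      then show ?thesis by (simp add: prod)
    qed
    have cl: "Poly_Mapping.single [(m, m+1), (1, n)] 1 -
        Poly_Mapping.single [(1, n), (m, m+1)] 1 \<in> ?R" if "2 \<le> m" "m \<le> n - 2" for m
    proof -
      have "gen m (m+1) * gen 1 n - gen 1 n * gen m (m+1) \<in> ?R"
        using that unfolding FK_relations_def by blast
      then show ?thesis using n by (simp add: prod)
    qed
    show ?thesis
      using ab(1)
    proof (cases rule: cycle_letters_cases)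
      case closing
      note a = this
      show ?thesis using ab(2)
      proof (cases rule: cycle_letters_cases)
        case closing
        then show ?thesis using a ab(3) by simp
      next
        case (path l)
        then have "2 \<le> l" "l \<le> n - 2" using a ab(3) n by auto
        from cl[OF this] show ?thesis using a path by simp
      qed
    next
      case (path m)
      note a = this
      show ?thesis using ab(2)
      proof (cases rule: cycle_letters_cases)
        case closing
        then have "2 \<le> m" "m \<le> n - 2" using a ab(3) n by auto
        from cl[OF this] show ?thesis using a closing by simp
      next
        case (path l)
        then consider "m + 2 \<le> l" | "l + 2 \<le> m" using a ab(3) by auto linarith
        then show ?thesis
          using far[of m l] far[of l m] a path by cases auto
      qed
    qed
  qed
qed

lemma free_act_superset:
  assumes "finite S" "Poly_Mapping.keys p \<subseteq> S"
  shows "free_act \<sigma> p = (\<Sum>w\<in>S. Poly_Mapping.single [] (Poly_Mapping.lookup p w) *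
    prod_list (map (\<lambda>(i, j). gen (\<sigma> i) (\<sigma> j)) w))"
  unfolding free_act_def using assms by (intro sum.mono_neutral_left) (auto simp: in_keys_iff)

lemma free_act_zero: "free_act \<sigma> 0 = 0"
  by (simp add: free_act_def)

lemma free_act_add: "free_act \<sigma> (p + q) = free_act \<sigma> p + free_act \<sigma> q"
proof -
  let ?S = "Poly_Mapping.keys p \<union> Poly_Mapping.keys q"
  have "Poly_Mapping.keys (p + q) \<subseteq> ?S" by (rule Poly_Mapping.keys_add)
  then show ?thesis
    by (simp add: free_act_superset[of ?S] lookup_add single_add distrib_right sum.distrib)
qed

lemma free_act_single:
  "free_act \<sigma> (Poly_Mapping.single w c) =
    Poly_Mapping.single [] c * prod_list (map (\<lambda>(i, j). gen (\<sigma> i) (\<sigma> j)) w)"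
  by (subst free_act_superset[of "{w}"]) auto

lemma free_act_scale:
  "free_act \<sigma> (Poly_Mapping.single [] c * p) = Poly_Mapping.single [] c * free_act \<sigma> p"
proof (induction p rule: poly_mapping_single_add_induct)
  case (single w d)
  then show ?case
    by (simp add: single_mult_single_list free_act_single mult.assoc[symmetric])
qed (simp_all add: free_act_zero free_act_add distrib_left)

definition reflect_edge :: "nat \<Rightarrow> nat \<times> nat \<Rightarrow> nat \<times> nat" where
  "reflect_edge n e = (n + 1 - snd e, n + 1 - fst e)"

lemma letter_bounds:
  assumes "e \<in> cycle_letters n" "n > 3"
  shows "1 \<le> fst e" "fst e < snd e" "snd e \<le> n"
  using assms(1) by (cases rule: cycle_letters_cases; use assms(2) in simp)+

lemma reflect_edge_in: "e \<in> cycle_letters n \<Longrightarrow> n > 3 \<Longrightarrow> reflect_edge n e \<in> cycle_letters n"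
  by (auto simp: cycle_letters_def reflect_edge_def)

lemma reflect_edge_involution: "e \<in> cycle_letters n \<Longrightarrow> n > 3 \<Longrightarrow> reflect_edge n (reflect_edge n e) = e"
  using letter_bounds[of e n] by (cases e) (auto simp: reflect_edge_def)

lemma reflect_edge_shares_vertex:
  assumes "e \<in> cycle_letters n" "f \<in> cycle_letters n" "n > 3"
  shows "shares_vertex (reflect_edge n e) (reflect_edge n f) \<longleftrightarrow> shares_vertex e f"
  using letter_bounds[OF assms(1,3)] letter_bounds[OF assms(2,3)]
  by (cases e, cases f) (auto simp: reflect_edge_def)

text \<open>
  Since the reflection reverses the order of the two ends of an edge, every letter contributes a
  factor \<open>-1\<close>.
\<close>

lemma reflection_word:
  assumes "set w \<subseteq> cycle_letters n" "n > 3"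
  shows "prod_list (map (\<lambda>(i, j). gen (reflection n i) (reflection n j)) w) =
    (Poly_Mapping.single (map (reflect_edge n) w) ((- 1) ^ length w) ::
      (nat \<times> nat) list \<Rightarrow>\<^sub>0 'a::field)"
  using assms(1)
proof (induction w)
  case Nil
  then show ?case by (metis list.map(1) list.size(3) power_0 prod_list.Nil single_one zero_list_def)
next
  case (Cons e w)
  obtain i j where e: "e = (i, j)" by fastforce
  have "gen (reflection n i) (reflection n j) =
      (Poly_Mapping.single [reflect_edge n e] (- 1) :: (nat \<times> nat) list \<Rightarrow>\<^sub>0 'a)"
    using letter_bounds[of e n] Cons.prems assms(2) e
    by (auto simp: gen_def reflection_def reflect_edge_def single_uminus)
  then show ?case using Cons e by (simp add: single_mult_single_list)
qed

lemma free_act_reflection_single: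
  assumes "set w \<subseteq> cycle_letters n" "n > 3"
  shows "free_act (reflection n) (Poly_Mapping.single w c) =
    Poly_Mapping.single (map (reflect_edge n) w) ((- 1) ^ length w * c)"
  by (simp add: free_act_single reflection_word[OF assms] single_mult_single_list mult.commute)

text \<open>
  In particular the reflection preserves the ideal, and the trace of the reflection counts
  invariant matchings with a sign.
\<close>

lemma set_coeff_free_act_reflection:
  assumes "n > 3" "p \<in> carrier (free_algebra (cycle_letters n))" "M \<subseteq> cycle_letters n"
  shows "set_coeff M (free_act (reflection n) p) = (- 1) ^ card M * set_coeff (reflect_edge n ` M) p"
  using assms(2)
proof (induction p rule: free_algebra_single_induct)
  case zero
  then show ?case by (simp add: free_act_zero)
next
  case (single w c)
  let ?r = "reflect_edge n"
  have inv: "?r (?r e) = e" if "e \<in> cycle_letters n" for e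
    using reflect_edge_involution[OF that assms(1)] .
  have "inj_on ?r (cycle_letters n)" by (rule inj_on_inverseI) (rule inv)
  then have "distinct (map ?r w) \<longleftrightarrow> distinct w"
    using single by (auto simp: distinct_map intro: inj_on_subset)
  moreover have "?r ` set w = M \<longleftrightarrow> set w = ?r ` M"
  proof -
    have inv_image: "?r ` ?r ` N = N" if "N \<subseteq> cycle_letters n" for N
      using that inv by (force simp: image_image)
    show ?thesis using inv_image[OF single] inv_image[OF assms(3)] by metis
  qed
  moreover have "length w = card M" if "distinct (map ?r w)" "?r ` set w = M"
    using that distinct_card[of "map ?r w"] by simp
  ultimately show ?case
    by (auto simp: free_act_reflection_single[OF single assms(1)] set_coeff_single)
next
  case (add p q)
  then show ?case by (simp add: free_act_add distrib_left)
qed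

definition reflected_matchings :: "nat \<Rightarrow> (nat \<times> nat) set set" where
  "reflected_matchings n = {M. M \<subseteq> cycle_letters n \<and> pairwise (\<lambda>e f. \<not> shares_vertex e f) M \<and>
    reflect_edge n ` M = M}"

text \<open>
  The diagonal entry at a matching \<open>M\<close> is \<open>(-1)^d\<close> if the reflection fixes \<open>M\<close>, and 0 otherwise.
\<close>

theorem graded_trace_reflection_nth:
  assumes n: "n > 3"
  shows "fps_nth (graded_trace n (reflection n) :: 'a::field fps) d =
    (- 1) ^ d * of_nat (card {M \<in> reflected_matchings n. card M = d})"
proof -
  interpret conflict_algebra "cycle_letters n" shares_vertex "FK_relations n :: (_ \<Rightarrow>\<^sub>0 'a) set"
    by (rule FK_conflict_algebra[OF n])
  let ?s = "reflection n" and ?r = "reflect_edge n"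
  have piece: "FK_cycle n\<lparr>carrier := FK_degree n d\<rparr> = graded_piece d"
    by (simp add: graded_piece_def FK_cycle_def FK_degree_def FK_ideal_def FK_free_def
        homogeneous_def)
  have indep: "independent (?r ` M)" if "independent M" for M
  proof -
    have M: "M \<subseteq> cycle_letters n" "pairwise (\<lambda>e f. \<not> shares_vertex e f) M"
      using that by (auto simp: independent_def)
    have "?r ` M \<subseteq> cycle_letters n" using M(1) reflect_edge_in[OF _ n] by blast
    moreover have "\<not> shares_vertex (?r e) (?r f)" if "e \<in> M" "f \<in> M" "?r e \<noteq> ?r f" for e f
    proof -
      have "e \<noteq> f" using that(3) by auto
      then have "\<not> shares_vertex e f" using pairwiseD[OF M(2) that(1,2)] by simp
      then show ?thesis using that(1,2) M(1) reflect_edge_shares_vertex[OF _ _ n, of e f] by auto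
    qed
    ultimately show ?thesis unfolding independent_def by (simp add: pairwise_def)
  qed
  have letters: "set (map ?r w) \<subseteq> cycle_letters n" if "set w \<subseteq> cycle_letters n" for w
    using that reflect_edge_in[OF _ n] by auto
  have carr: "free_act ?s p \<in> carrier A" if "p \<in> carrier A" for p
    using that
  proof (induction p rule: free_algebra_single_induct)
    case (single w c)
    then show ?case
      unfolding free_act_reflection_single[OF single n]
      by (intro single_in_free_algebra letters)
  next
    case (add p q)
    then show ?case
      using ring.ring_simprules(1)[OF free_algebra_ring, of _ "cycle_letters n"]
      by (simp add: free_act_add free_algebra_simps(3))
  qed (simp add: free_act_zero free_algebra_simps)
  have hom: "free_act ?s p \<in> homogeneous d" if p: "p \<in> homogeneous d" for p
  proof (induction p rule: poly_mapping_single_add_induct)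
    case (single w c)
    then have w: "set w \<subseteq> cycle_letters n" "length w = d"
      using p by (auto simp: homogeneous_def free_algebra_simps)
    then show ?case
      unfolding free_act_reflection_single[OF w(1) n]
      using letters[OF w(1)] w(2) homogeneous_zero
      by (auto simp: homogeneous_def intro!: single_in_free_algebra)
  qed (simp_all add: free_act_zero free_act_add homogeneous_zero homogeneous_add)
  have act: "FK_act n ?s (I +>\<^bsub>A\<^esub> p) = I +>\<^bsub>A\<^esub> free_act ?s p" if p: "p \<in> homogeneous d" for p
  proof -
    have "I +>\<^bsub>A\<^esub> free_act ?s q = I +>\<^bsub>A\<^esub> free_act ?s p" if q: "q \<in> I +>\<^bsub>A\<^esub> p" for q
    proof -
      note p' = homogeneous_carrier[OF p] and q' = mem_coset[OF q homogeneous_carrier[OF p]]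
      have "set_coeff M (free_act ?s q) = set_coeff M (free_act ?s p)" if M: "independent M" for M
        using q' p' indep[OF M] M
        by (simp add: set_coeff_free_act_reflection[OF n] coset_eq_iff independent_def[of M])
      then show ?thesis by (simp add: coset_eq_iff carr p' q')
    qed
    then show ?thesis
      unfolding FK_act_def FK_ideal_def FK_free_def
      using coset_self[OF homogeneous_carrier[OF p]] by blast
  qed
  have "fps_nth (graded_trace n ?s :: 'a fps) d = trace_on class_ring (graded_piece d) (FK_act n ?s)"
    by (simp add: graded_trace_def piece)
  also have "\<dots> = (\<Sum>M | independent M \<and> card M = d. set_coeff M (free_act ?s (set_monomial M)))"
    by (rule trace_graded_piece) (simp_all add: hom act free_act_add free_act_scale)
  also have "\<dots> = (\<Sum>M | independent M \<and> card M = d. if ?r ` M = M then (- 1) ^ d else 0)"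
    proof (rule sum.cong[OF refl])
    fix M assume "M \<in> {M. independent M \<and> card M = d}"
    then have M: "independent M" "card M = d" "M \<subseteq> cycle_letters n"
      by (auto simp: independent_def)
    show "set_coeff M (free_act ?s (set_monomial M)) = (if ?r ` M = M then (- 1) ^ d else 0)"
      using set_coeff_free_act_reflection[OF n homogeneous_carrier[OF homogeneous_set_monomial] M(3)]
        M(1,2) by (auto simp: set_coeff_set_monomial)
  qed
  also have "\<dots> = (- 1) ^ d * of_nat (card {M \<in> reflected_matchings n. card M = d})"
  proof -
    have "finite {M. independent M \<and> card M = d}"
      by (rule finite_subset[OF _ finite_independent]) auto
    moreover have "{M. independent M \<and> card M = d} \<inter> {M. ?r ` M = M} =
        {M \<in> reflected_matchings n. card M = d}"
      by (auto simp: reflected_matchings_def independent_def)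
    ultimately show ?thesis by (simp add: sum.If_cases)
  qed
  finally show ?thesis .
qed

section \<open>Counting reflected matchings\<close>

definition sparse :: "nat set \<Rightarrow> bool" where
  "sparse S \<longleftrightarrow> (\<forall>i\<in>S. Suc i \<notin> S)"

text \<open>
  Pascal's rule: a sparse subset of an interval of length \<open>h + 2\<close> either misses the last point, or
  contains it and misses the one before.
\<close>

lemma card_sparse_subsets:
  "card {S. S \<subseteq> {a..<a + h} \<and> sparse S \<and> card S = k} = (h + 1 - k) choose k"
proof (induction h arbitrary: k rule: induct_nat_012)
  case 0
  have "{S. S \<subseteq> {a..<a + 0} \<and> sparse S \<and> card S = k} = (if k = 0 then {{}} else {})"
    by (auto simp: sparse_def)
  then show ?case by (cases k) auto
next
  case 1
  have "{S. S \<subseteq> {a..<a + Suc 0} \<and> sparse S \<and> card S = k} =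
      (if k = 0 then {{}} else if k = 1 then {{a}} else {})"
    by (auto simp: sparse_def subset_singleton_iff)
  then show ?case by (cases k rule: nat.exhaust; cases "k = 1") (auto simp: binomial_eq_0)
next
  case (ge2 h)
  let ?F = "\<lambda>h k. {S. S \<subseteq> {a..<a + h} \<and> sparse S \<and> card S = k}"
  have fin: "finite (?F h k)" for h k by (rule finite_subset[of _ "Pow {a..<a + h}"]) auto
  have fin_elem: "finite S" if "S \<subseteq> {a..<a + h}" for S h using that finite_subset by blast
  show ?case
  proof (cases k)
    case 0
    then have "?F (Suc (Suc h)) k = {{}}"
      using fin_elem[of _ "Suc (Suc h)"] by (auto simp: sparse_def card_eq_0_iff)
    then show ?thesis using 0 by simp
  next
    case (Suc j)
    let ?ins = "insert (a + Suc h)"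
    have "?F (Suc (Suc h)) k = ?F (Suc h) k \<union> ?ins ` ?F h j"
    proof (intro equalityI subsetI)
      fix S assume S: "S \<in> ?F (Suc (Suc h)) k"
      show "S \<in> ?F (Suc h) k \<union> ?ins ` ?F h j"
      proof (cases "a + Suc h \<in> S")
        case False
        then have "x < a + Suc h" if "x \<in> S" for x
          using S that by (cases "x = a + Suc h") (auto simp: subset_iff less_Suc_eq)
        then show ?thesis using S by auto
      next
        case True
        then have "a + h \<notin> S" using S by (auto simp: sparse_def)
        have sub: "S - {a + Suc h} \<subseteq> {a..<a + h}"
        proof
          fix x assume "x \<in> S - {a + Suc h}"
          then have "a \<le> x" "x < a + Suc (Suc h)" "x \<noteq> a + h" "x \<noteq> a + Suc h"
            using S \<open>a + h \<notin> S\<close> by auto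
          then show "x \<in> {a..<a + h}" by simp
        qed
        have "S - {a + Suc h} \<in> ?F h j"
          using S True Suc by (intro CollectI conjI sub) (auto simp: sparse_def)
        then show ?thesis
          using True by (intro UnI2 image_eqI[of _ _ "S - {a + Suc h}"]) (simp_all add: insert_absorb)
      qed
    next
      fix S assume "S \<in> ?F (Suc h) k \<union> ?ins ` ?F h j"
      then show "S \<in> ?F (Suc (Suc h)) k"
      proof
        assume "S \<in> ?ins ` ?F h j"
        then obtain U where U: "U \<subseteq> {a..<a + h}" "sparse U" "card U = j" and S: "S = ?ins U"
          by auto
        have "a + Suc h \<notin> U" "finite U" "Suc (a + Suc h) \<notin> U" "\<forall>i\<in>U. Suc i \<noteq> a + Suc h"
          using U(1) fin_elem by auto
        then show ?thesis using U S Suc by (auto simp: sparse_def)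
      qed auto
    qed
    moreover have "?F (Suc h) k \<inter> ?ins ` ?F h j = {}" by auto
    moreover have "inj_on ?ins (?F h j)"
    proof (rule inj_onI)
      fix U W assume "U \<in> ?F h j" "W \<in> ?F h j" and eq: "?ins U = ?ins W"
      then have "a + Suc h \<notin> U" "a + Suc h \<notin> W" by auto
      then show "U = W" using eq by (metis Diff_insert_absorb)
    qed
    ultimately have "card (?F (Suc (Suc h)) k) = card (?F (Suc h) k) + card (?F h j)"
      using fin by (simp add: card_Un_disjoint card_image)
    also have "\<dots> = (Suc (Suc h) + 1 - k) choose k"
      using ge2 Suc by (cases "j \<le> h + 1") (auto simp: Suc_diff_le)
    finally show ?thesis .
  qed
qed

text \<open>
  The path edges \<open>{m, m + 1}\<close> for \<open>m\<close> in \<open>S\<close> together with their images under the reflection.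
\<close>

definition mirrored_edges :: "nat \<Rightarrow> nat set \<Rightarrow> (nat \<times> nat) set" where
  "mirrored_edges n S = (\<lambda>m. (m, m + 1)) ` S \<union> (\<lambda>m. (n - m, n - m + 1)) ` S"

lemma mem_mirrored_edges:
  "(i, j) \<in> mirrored_edges n S \<longleftrightarrow> j = i + 1 \<and> (i \<in> S \<or> (\<exists>m\<in>S. i = n - m))"
  by (auto simp: mirrored_edges_def)

context
  fixes n h :: nat
  assumes n: "n = 2 * h + 3" and h: "h \<ge> 1"
begin

lemma mirrored_edges_left:
  assumes "S \<subseteq> {1..h}" "i \<le> h"
  shows "(i, i + 1) \<in> mirrored_edges n S \<longleftrightarrow> i \<in> S"
  using assms n by (force simp: mem_mirrored_edges)

lemma inj_mirrored_edges: "inj_on (mirrored_edges n) (Pow {1..h})"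
proof (rule inj_onI)
  fix S U assume "S \<in> Pow {1..h}" "U \<in> Pow {1..h}" "mirrored_edges n S = mirrored_edges n U"
  then have "i \<in> S \<longleftrightarrow> i \<in> U" if "i \<le> h" for i
    using mirrored_edges_left[of S i] mirrored_edges_left[of U i] that by auto
  with \<open>S \<in> _\<close> \<open>U \<in> _\<close> show "S = U" by (auto simp: subset_iff)
qed

lemma card_mirrored_edges:
  assumes "S \<subseteq> {1..h}"
  shows "card (mirrored_edges n S) = 2 * card S" "finite (mirrored_edges n S)"
    "(1, n) \<notin> mirrored_edges n S"
proof -
  have fin: "finite S" using assms finite_subset by blast
  then show "finite (mirrored_edges n S)" by (simp add: mirrored_edges_def)
  have "inj_on (\<lambda>m. (m, m + 1)) S" by (auto simp: inj_on_def)
  moreover have "inj_on (\<lambda>m. (n - m, n - m + 1)) S"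
    using assms n by (auto simp: inj_on_def subset_iff)
  moreover have "(\<lambda>m. (m, m + 1)) ` S \<inter> (\<lambda>m. (n - m, n - m + 1)) ` S = {}"
  proof -
    have "m \<noteq> n - l" if "m \<in> S" "l \<in> S" for m l
    proof -
      have "m \<le> h" "l \<le> h" using assms that by auto
      then show ?thesis using n by linarith
    qed
    then show ?thesis by auto
  qed
  ultimately show "card (mirrored_edges n S) = 2 * card S"
    unfolding mirrored_edges_def using fin by (subst card_Un_disjoint) (auto simp: card_image)
  show "(1, n) \<notin> mirrored_edges n S" using n h by (auto simp: mem_mirrored_edges)
qed

lemma reflect_mirrored_edges:
  assumes "S \<subseteq> {1..h}"
  shows "reflect_edge n ` mirrored_edges n S = mirrored_edges n S"
proof -
  have "reflect_edge n ` (\<lambda>m. (m, m + 1)) ` S = (\<lambda>m. (n - m, n - m + 1)) ` S"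
    unfolding image_image using assms n by (intro image_cong) (auto simp: reflect_edge_def subset_iff)
  moreover have "reflect_edge n ` (\<lambda>m. (n - m, n - m + 1)) ` S = (\<lambda>m. (m, m + 1)) ` S"
    unfolding image_image using assms n by (intro image_cong) (auto simp: reflect_edge_def subset_iff)
  ultimately show ?thesis unfolding mirrored_edges_def image_Un by blast
qed

lemma mirrored_edges_matching:
  assumes S: "S \<subseteq> {1..h}" "sparse S"
  shows "mirrored_edges n S \<in> reflected_matchings n"
    and "1 \<notin> S \<Longrightarrow> insert (1, n) (mirrored_edges n S) \<in> reflected_matchings n"
proof -
  have letters: "mirrored_edges n S \<subseteq> cycle_letters n"
    using S n by (auto simp: mirrored_edges_def cycle_letters_def subset_iff)
  have pair: "pairwise (\<lambda>e f. \<not> shares_vertex e f) (mirrored_edges n S)"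
  proof (rule pairwiseI)
    fix e f assume "e \<in> mirrored_edges n S" "f \<in> mirrored_edges n S" "e \<noteq> f"
    then obtain i j where ij: "e = (i, i + 1)" "f = (j, j + 1)" "i \<noteq> j"
      and i: "i \<in> S \<or> (\<exists>m\<in>S. i = n - m)" and j: "j \<in> S \<or> (\<exists>m\<in>S. j = n - m)"
      by (cases e, cases f) (auto simp: mem_mirrored_edges)
    have no_succ: False if "i \<in> S \<or> (\<exists>m\<in>S. i = n - m)" "Suc i \<in> S \<or> (\<exists>m\<in>S. Suc i = n - m)" for i
    proof -
      have bd: "1 \<le> m" "m \<le> h" if "m \<in> S" for m using S that by auto
      consider "i \<in> S" "Suc i \<in> S" | m where "i \<in> S" "m \<in> S" "Suc i = n - m"
        | m where "m \<in> S" "i = n - m" "Suc i \<in> S"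
        | m l where "m \<in> S" "l \<in> S" "i = n - m" "Suc i = n - l"
        using \<open>i \<in> S \<or> _\<close> \<open>Suc i \<in> S \<or> _\<close> by blast
      then show False
      proof cases
        case 1 then show False using S by (auto simp: sparse_def)
      next
        case (2 m) then show False using bd[of i] bd[of m] n by linarith
      next
        case (3 m) then show False using bd[of m] bd[of "Suc i"] n by linarith
      next
        case (4 m l)
        then have "m = Suc l" using bd[of m] bd[of l] n by linarith
        with 4 S show False by (auto simp: sparse_def)
      qed
    qed
    show "\<not> shares_vertex e f"
    proof
      assume "shares_vertex e f"
      then have "j = Suc i \<or> i = Suc j" using ij by auto
      then show False using no_succ[of i] no_succ[of j] i j by metis
    qed
  qed
  show "mirrored_edges n S \<in> reflected_matchings n"
    using letters pair reflect_mirrored_edges[OF S(1)] by (simp add: reflected_matchings_def)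
  show "insert (1, n) (mirrored_edges n S) \<in> reflected_matchings n" if one: "1 \<notin> S"
  proof -
    have far: "\<not> shares_vertex (1, n) f" "\<not> shares_vertex f (1, n)"
      if f_mem: "f \<in> mirrored_edges n S" for f
    proof -
      obtain i where f: "f = (i, i + 1)" and i: "i \<in> S \<or> (\<exists>m\<in>S. i = n - m)"
        using f_mem by (cases f) (auto simp: mem_mirrored_edges)
      have bd: "2 \<le> m \<and> m \<le> h" if "m \<in> S" for m
      proof -
        have "1 \<le> m" "m \<le> h" "m \<noteq> 1" using S that one by auto
        then show ?thesis by simp
      qed
      from i have "2 \<le> i \<and> i + 1 < n"
      proof
        assume "i \<in> S"
        then show ?thesis using bd[of i] n by simp
      next
        assume "\<exists>m\<in>S. i = n - m"
        then obtain m where "m \<in> S" "i = n - m" by blast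
        then show ?thesis using bd[of m] n by linarith
      qed
      then show "\<not> shares_vertex (1, n) f" "\<not> shares_vertex f (1, n)" using f by auto
    qed
    have "pairwise (\<lambda>e f. \<not> shares_vertex e f) (insert (1, n) (mirrored_edges n S))"
      using pair far by (auto simp: pairwise_insert)
    moreover have "reflect_edge n (1, n) = (1, n)" by (simp add: reflect_edge_def)
    ultimately show ?thesis
      using letters reflect_mirrored_edges[OF S(1)]
      by (simp add: reflected_matchings_def cycle_letters_def)
  qed
qed

text \<open>
  The set \<open>S\<close> collects the left ends of the edges on the first half of the path. The edges starting
  at \<open>h + 1\<close> and \<open>h + 2\<close> are exchanged by the reflection and meet in the middle vertex, so neither
  belongs to an invariant matching; any edge further right is the mirror image of one on the left.
\<close>

lemma reflected_matching_decomposition: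
  assumes M: "M \<in> reflected_matchings n"
  obtains S where "S \<subseteq> {1..h}" "sparse S" "M - {(1, n)} = mirrored_edges n S"
    "(1, n) \<in> M \<longrightarrow> 1 \<notin> S"
proof
  define S where "S = {i \<in> {1..h}. (i, i + 1) \<in> M}"
  have sub: "M \<subseteq> cycle_letters n" and inv: "reflect_edge n ` M = M"
    using M by (auto simp: reflected_matchings_def)
  have apart: "\<not> shares_vertex e f" if "e \<in> M" "f \<in> M" "e \<noteq> f" for e f
    using M that by (auto simp: reflected_matchings_def pairwise_def)
  have refl: "reflect_edge n e \<in> M" if "e \<in> M" for e using inv that by blast
  have refl_path: "(n - i, n - i + 1) \<in> M" if "(i, i + 1) \<in> M" "i < n" for i
    using refl[OF that(1)] that(2) by (auto simp: reflect_edge_def Suc_diff_le)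
  show S: "S \<subseteq> {1..h}" by (auto simp: S_def)
  show "sparse S"
    unfolding sparse_def S_def
  proof safe
    fix i assume "(i, i + 1) \<in> M" "(Suc i, Suc i + 1) \<in> M"
    then show False using apart[of "(i, i + 1)" "(Suc i, Suc i + 1)"] by simp
  qed
  show "(1, n) \<in> M \<longrightarrow> 1 \<notin> S"
    using apart[of "(1, n)" "(1, 1 + 1)"] n by (auto simp: S_def)
  show "M - {(1, n)} = mirrored_edges n S"
  proof (intro equalityI subsetI)
    fix e assume e: "e \<in> M - {(1, n)}"
    then have "e \<in> cycle_letters n" using sub by blast
    then obtain i where i: "1 \<le> i" "i \<le> n - 1" "e = (i, i + 1)"
      by (cases rule: cycle_letters_cases) (use e in auto)
    have r: "(n - i, n - i + 1) \<in> M" using refl_path[of i] e i n by auto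
    have "\<not> (i = h + 1 \<or> i = h + 2)"
      using apart[of "(i, i + 1)" "(n - i, n - i + 1)"] e r i n by auto
    then consider "i \<le> h" | "h + 3 \<le> i" by linarith
    then show "e \<in> mirrored_edges n S"
    proof cases
      case 1
      then show ?thesis using e i by (auto simp: mem_mirrored_edges S_def)
    next
      case 2
      then have "n - i \<in> S" "i = n - (n - i)" using r i n by (auto simp: S_def)
      then show ?thesis using i(3) mem_mirrored_edges by blast
    qed
  next
    fix e assume e: "e \<in> mirrored_edges n S"
    obtain i j where ij: "e = (i, j)" by fastforce
    have "e \<in> M"
      using e refl_path n unfolding ij by (auto simp: mem_mirrored_edges S_def)
    moreover have "e \<noteq> (1, n)" using card_mirrored_edges(3)[OF S] e by blast
    ultimately show "e \<in> M - {(1, n)}" by blast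
  qed
qed

lemma card_reflected_matchings_even:
  "card {M \<in> reflected_matchings n. card M = 2 * k} = (h + 1 - k) choose k"
proof -
  let ?F = "{S. S \<subseteq> {1..<1 + h} \<and> sparse S \<and> card S = k}"
  have F: "S \<subseteq> {1..h}" if "S \<in> ?F" for S using that by auto
  have "{M \<in> reflected_matchings n. card M = 2 * k} = mirrored_edges n ` ?F"
  proof (intro equalityI subsetI)
    fix M assume M: "M \<in> {M \<in> reflected_matchings n. card M = 2 * k}"
    then have "M \<in> reflected_matchings n" by simp
    then obtain S where S: "S \<subseteq> {1..h}" "sparse S" "M - {(1, n)} = mirrored_edges n S"
      by (rule reflected_matching_decomposition)
    have "(1, n) \<notin> M"
    proof
      assume "(1, n) \<in> M"
      then have "M = insert (1, n) (mirrored_edges n S)" using S(3) by blast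
      then have "card M = Suc (2 * card S)" using card_mirrored_edges[OF S(1)] by simp
      then show False using M by simp presburger
    qed
    then have M_eq: "M = mirrored_edges n S" using S(3) by simp
    then have "S \<in> ?F"
      using S(1,2) M card_mirrored_edges(1)[OF S(1)]
      by (simp add: atLeastLessThanSuc_atLeastAtMost)
    then show "M \<in> mirrored_edges n ` ?F" using M_eq by blast
  next
    fix M assume "M \<in> mirrored_edges n ` ?F"
    then show "M \<in> {M \<in> reflected_matchings n. card M = 2 * k}"
      using mirrored_edges_matching(1) card_mirrored_edges(1) F by auto
  qed
  moreover have "inj_on (mirrored_edges n) ?F"
    using inj_mirrored_edges by (rule inj_on_subset) auto
  ultimately show ?thesis using card_sparse_subsets[of 1 h k] by (simp add: card_image)
qed

text \<open>
  An odd size forces the only fixed edge \<open>{1, n}\<close> to be present, which rules out the edge starting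
  at 1 and leaves the \<open>h - 1\<close> path edges starting at \<open>2, \<dots>, h\<close>.
\<close>

lemma card_reflected_matchings_odd:
  "card {M \<in> reflected_matchings n. card M = 2 * k + 1} = (h - k) choose k"
proof -
  let ?F = "{S. S \<subseteq> {2..<2 + (h - 1)} \<and> sparse S \<and> card S = k}"
  let ?f = "\<lambda>S. insert (1, n) (mirrored_edges n S)"
  have F: "S \<subseteq> {1..h}" "1 \<notin> S" if "S \<in> ?F" for S using that h by (auto simp: subset_iff)
  have "{M \<in> reflected_matchings n. card M = 2 * k + 1} = ?f ` ?F"
  proof (intro equalityI subsetI)
    fix M assume M: "M \<in> {M \<in> reflected_matchings n. card M = 2 * k + 1}"
    then have "M \<in> reflected_matchings n" by simp
    then obtain S where S: "S \<subseteq> {1..h}" "sparse S" "M - {(1, n)} = mirrored_edges n S"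
      and one: "(1, n) \<in> M \<longrightarrow> 1 \<notin> S"
      by (rule reflected_matching_decomposition)
    have in_M: "(1, n) \<in> M"
    proof (rule ccontr)
      assume "(1, n) \<notin> M"
      then have "card M = 2 * card S" using S(3) card_mirrored_edges[OF S(1)] by simp
      then show False using M by simp presburger
    qed
    then have M_eq: "M = ?f S" using S(3) by blast
    then have "card M = Suc (2 * card S)" using card_mirrored_edges[OF S(1)] by simp
    moreover have "S \<subseteq> {2..<2 + (h - 1)}"
    proof
      fix x assume x: "x \<in> S"
      then have "x \<noteq> 1" using one in_M by auto
      then show "x \<in> {2..<2 + (h - 1)}" using x S(1) by fastforce
    qed
    ultimately show "M \<in> ?f ` ?F" using S M M_eq by auto
  next
    fix M assume "M \<in> ?f ` ?F"
    then obtain S where S: "S \<in> ?F" and M: "M = ?f S" by blast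
    then show "M \<in> {M \<in> reflected_matchings n. card M = 2 * k + 1}"
      using mirrored_edges_matching(2)[OF F(1)[OF S] _ F(2)[OF S]] card_mirrored_edges[OF F(1)[OF S]]
      by simp
  qed
  moreover have "inj_on ?f ?F"
  proof (rule inj_onI)
    fix S U assume SU: "S \<in> ?F" "U \<in> ?F" and eq: "?f S = ?f U"
    have "mirrored_edges n S = mirrored_edges n U"
      using eq card_mirrored_edges(3)[OF F(1)[OF SU(1)]] card_mirrored_edges(3)[OF F(1)[OF SU(2)]]
      by (metis Diff_insert_absorb)
    then show "S = U"
      using inj_onD[OF inj_mirrored_edges, of S U] F(1)[OF SU(1)] F(1)[OF SU(2)] by simp
  qed
  ultimately show ?thesis using card_sparse_subsets[of 2 "h - 1" k] h by (simp add: card_image)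
qed

end

section \<open>The graded trace of the reflection\<close>

lemma poly_q_fibonacci:
  "poly (q_fibonacci m) (x :: 'a::comm_semiring_1) =
    (\<Sum>k = 0..m div 2. of_nat ((m - k) choose k) * x ^ k)"
  by (simp add: q_fibonacci_def poly_sum poly_monom)

theorem lemma2p24:
  fixes n :: nat
  assumes "n > 3" and "odd n"
  shows "(graded_trace n (reflection n) :: 'a::field fps) =
           (\<Sum>k = 0..(n - 1) div 4. of_nat (((n - 1) div 2 - k) choose k) * fps_X ^ (2 * k))
         - (\<Sum>k = 0..(n - 3) div 4. of_nat (((n - 3) div 2 - k) choose k) * fps_X ^ (2 * k + 1))
       \<and> (graded_trace n (reflection n) :: 'a::field fps) =
           poly (q_fibonacci ((n - 1) div 2)) (fps_X ^ 2)
         - fps_X * poly (q_fibonacci ((n - 3) div 2)) (fps_X ^ 2)"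
proof -
  define h where "h = (n - 3) div 2"
  have n: "n = 2 * h + 3" and h: "h \<ge> 1"
    using assms unfolding h_def by presburger+
  have bounds: "(n - 1) div 2 = h + 1" "(n - 3) div 2 = h"
    "(n - 1) div 4 = (h + 1) div 2" "(n - 3) div 4 = h div 2"
    using n by auto
  \<comment> \<open>The sums stop at half of the upper index because all later binomial coefficients are 0.\<close>
  have vanish: "(N - k) choose k = 0" if "\<not> k \<le> N div 2" for N k :: nat
    using that by (intro binomial_eq_0) auto
  let ?E = "\<lambda>K c. \<Sum>k = 0..K. of_nat (c k) * fps_X ^ (2 * k) :: 'a fps"
  have coeff: "fps_nth (?E K c) d = (if even d \<and> d div 2 \<le> K then of_nat (c (d div 2)) else 0)" for K c d
  proof -
    have "fps_nth (?E K c) d = (\<Sum>k = 0..K. if k = d div 2 \<and> even d then of_nat (c k) else 0)"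
      unfolding fps_sum_nth
      by (intro sum.cong) (auto simp: fps_of_nat[symmetric])
    then show ?thesis by (cases "even d") auto
  qed
  have shift: "(\<Sum>k = 0..K. of_nat (c k) * fps_X ^ (2 * k + 1)) = fps_X * ?E K c" for K c
    by (simp add: sum_distrib_left ac_simps)
  have main: "(graded_trace n (reflection n) :: 'a fps) =
      ?E ((h + 1) div 2) (\<lambda>k. (h + 1 - k) choose k) - fps_X * ?E (h div 2) (\<lambda>k. (h - k) choose k)"
  proof (rule fps_ext)
    fix d
    show "fps_nth (graded_trace n (reflection n) :: 'a fps) d =
      fps_nth (?E ((h + 1) div 2) (\<lambda>k. (h + 1 - k) choose k)
        - fps_X * ?E (h div 2) (\<lambda>k. (h - k) choose k)) d"
    proof (cases "even d")
      case True
      then obtain k where "d = 2 * k" by blast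
      then show ?thesis
        using vanish[of k "h + 1"]
        by (simp add: graded_trace_reflection_nth[OF assms(1)] coeff
            card_reflected_matchings_even[OF n h] binomial_eq_0)
    next
      case False
      then obtain k where "d = 2 * k + 1" by (elim oddE)
      then show ?thesis
        using vanish[of k h]
        by (simp add: graded_trace_reflection_nth[OF assms(1)] coeff
            card_reflected_matchings_odd[OF n h, simplified] binomial_eq_0)
    qed
  qed
  show ?thesis
    unfolding bounds shift main poly_q_fibonacci by (simp add: power_mult[symmetric])
qed

end
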